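(* For each integer $n\ge 1$ let $S_n$ be the iterated function system determined by the maps $g_1,\dots,g_n$ and let $J_n$ be its limit set. Let $h_n$ be the packing dimension of $J_n$ and let $\mathcal{P}_{h_n}$ be the $h_n$-dimensional packing measure. Then $$\lim_{n\to\infty}\mathcal{P}_{h_n}(J_n)=2 .$$
   Context: For each integer $k\ge 1$, $f_k:[\frac1{k+1},\frac1k]\to[0,1]$ is the decreasing affine function with $f_k(\frac1{k+1})=1$ and $f_k(\frac1k)=0$, and $g_k=f_k^{-1}:[0,1]\to[\frac1{k+1},\frac1k]$. The limit set is $J_n=\bigcap_{l\ge1}\bigcup_{(q_1,\dots,q_l)\in\{1,\dots,n\}^l} g_{q_1}\circ\cdots\circ g_{q_l}([0,1])$. Packing measure: for $E\subset\mathbb{R}$, a $\delta$-packing of $E$ is a countable family of pairwise disjoint closed balls (intervals $[x-r,x+r]$, $0<r\le\delta$) with centers $x\in E$. For $s\ge 0$ let $P^s_\delta(E)=\sup\{\sum_i |B_i|^s : \{B_i\}\text{ a }\delta\text{-packing of }E\}$, where $|B_i|$ is the diameter of $B_i$; the packing premeasure is $P^{pre}_s(E)=\inf_{\delta>0}P^s_\delta(E)$; and $\mathcal{P}_s(E)=\inf\{\sum_{i=1}^\infty P^{pre}_s(E_i): E\subset\bigcup_{i=1}^\infty E_i\}$. The packing dimension of $E$ is $\inf\{s\ge0:\mathcal{P}_s(E)=0\}$. For $J_n$ it equals the Hausdorff dimension and $h_n$ is the unique solution of $\sum_{k=1}^n(\frac1k-\frac1{k+1})^{h_n}=1$. *)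

theory Defs
  imports "HOL-Analysis.Analysis"
begin

(* The decreasing affine map sending 1/(k+1) to 1 and 1/k to 0 (for k >= 1). *)
definition branch :: "nat \<Rightarrow> real \<Rightarrow> real" where
  "branch k x = real k * (real k + 1) * (1 / real k - x)"

definition inv_branch :: "nat \<Rightarrow> real \<Rightarrow> real" where
  "inv_branch k = inv_into {1 / (real k + 1) .. 1 / real k} (branch k)"

lemma branch_endpoints:
  assumes "k \<ge> 1"
  shows "branch k (1 / (real k + 1)) = 1" "branch k (1 / real k) = 0"
proof -
  have "real k \<noteq> 0" "real k + 1 \<noteq> 0" using assms by auto
  then have "1 / real k - 1 / (real k + 1) = 1 / (real k * (real k + 1))"
    by (simp add: diff_frac_eq)
  with \<open>real k \<noteq> 0\<close> \<open>real k + 1 \<noteq> 0\<close> show "branch k (1 / (real k + 1)) = 1"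
    by (simp add: branch_def)
  show "branch k (1 / real k) = 0" by (simp add: branch_def)
qed

lemma bij_betw_branch_aux:
  assumes "k \<ge> 1"
  defines "g \<equiv> \<lambda>y. 1 / real k - y / (real k * (real k + 1))"
  shows "\<forall>x. g (branch k x) = x" "\<forall>y. branch k (g y) = y"
    "branch k ` {1 / (real k + 1) .. 1 / real k} \<subseteq> {0..1}"
    "g ` {0..1} \<subseteq> {1 / (real k + 1) .. 1 / real k}"
proof -
  define c where "c = real k * (real k + 1)"
  have c: "c > 0" using assms(1) by (simp add: c_def)
  have k: "real k \<noteq> 0" "real k + 1 \<noteq> 0" using assms(1) by auto
  have "1 / real k - 1 / (real k + 1) = 1 / c"
    using k by (simp add: diff_frac_eq c_def)
  then have d: "1 / (real k + 1) = 1 / real k - 1 / c" by linarith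
  have b: "branch k x = c * (1 / real k - x)" for x by (simp add: branch_def c_def)
  have g: "g y = 1 / real k - y / c" for y by (simp add: g_def c_def)
  show "\<forall>x. g (branch k x) = x" "\<forall>y. branch k (g y) = y" using c by (simp_all add: b g)
  have "c * (1 / real k - x) \<le> 1" if "1 / real k - 1 / c \<le> x" for x
  proof -
    have "c * (1 / real k - x) \<le> c * (1 / c)"
      using that c by (intro mult_left_mono) auto
    then show ?thesis using c by simp
  qed
  then show "branch k ` {1 / (real k + 1) .. 1 / real k} \<subseteq> {0..1}"
    using c unfolding d by (auto simp: b intro!: mult_nonneg_nonneg)
  show "g ` {0..1} \<subseteq> {1 / (real k + 1) .. 1 / real k}"
    using c unfolding d by (auto simp: g divide_right_mono)
qed

lemma bij_betw_branch:
  assumes "k \<ge> 1"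
  shows "bij_betw (branch k) {1 / (real k + 1) .. 1 / real k} {0..1}"
  using bij_betw_branch_aux[OF assms]
  by (intro bij_betw_byWitness[where f' = "\<lambda>y. 1 / real k - y / (real k * (real k + 1))"])
     (blast | simp)+

lemma inv_branch_eq:
  assumes "k \<ge> 1" "y \<in> {0..1}"
  shows "inv_branch k y = 1 / real k - y / (real k * (real k + 1))"
  unfolding inv_branch_def
  using bij_betw_branch_aux[OF assms(1)] assms(2)
  by (intro inv_into_f_eq[OF bij_betw_imp_inj_on[OF bij_betw_branch[OF assms(1)]]]) (blast | simp)+

(* For q = [q1, ..., ql], foldr inv_branch q is the composition g_q1 o ... o g_ql. *)
definition limit_set :: "nat \<Rightarrow> real set" where
  "limit_set n =
     (\<Inter>l\<in>{1..}. \<Union>q\<in>{q. length q = l \<and> set q \<subseteq> {1..n}}. foldr inv_branch q ` {0..1})"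

(* A pairwise disjoint family of closed balls of positive radius never repeats a ball,
   so a packing is represented by its set of balls. *)
definition packings :: "real \<Rightarrow> real set \<Rightarrow> real set set set" where
  "packings \<delta> E =
     {\<B>. countable \<B> \<and> disjoint \<B> \<and>
         (\<forall>B\<in>\<B>. \<exists>x\<in>E. \<exists>r. 0 < r \<and> r \<le> \<delta> \<and> B = cball x r)}"

definition packing_sup :: "real \<Rightarrow> real \<Rightarrow> real set \<Rightarrow> ennreal" where
  "packing_sup s \<delta> E = (SUP \<B>\<in>packings \<delta> E. \<Sum>\<^sub>\<infinity>B\<in>\<B>. ennreal (diameter B powr s))"

definition packing_premeasure :: "real \<Rightarrow> real set \<Rightarrow> ennreal" where
  "packing_premeasure s E = (INF \<delta>\<in>{0<..}. packing_sup s \<delta> E)"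

definition packing_measure :: "real \<Rightarrow> real set \<Rightarrow> ennreal" where
  "packing_measure s E =
     (INF A\<in>{A :: nat \<Rightarrow> real set. E \<subseteq> (\<Union>i. A i)}. \<Sum>i. packing_premeasure s (A i))"

(* The infimum is over a nonempty set bounded below: subsets of the line are null for s > 1. *)
definition packing_dim :: "real set \<Rightarrow> real" where
  "packing_dim E = Inf {s. 0 \<le> s \<and> packing_measure s E = 0}"

end

theory Submission
  imports Defs "HOL-Real_Asymp.Real_Asymp"
begin

text \<open>
  Let \<open>h\<close> solve the Moran equation: the \<open>h\<close>-th powers of the first \<open>n\<close> interval lengths sum to \<open>1\<close>.
  Then \<open>1 - h \<le> 2/n\<close>, so \<open>(n (n + 1)) powr (1 - h)\<close> tends to \<open>1\<close>, and the self-similar measure on the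
  limit set is uniformly close to Lebesgue measure.

  Upper bound: renormalise a ball with centre \<open>x\<close> in the limit set until it no longer fits into the
  first-level cylinder of \<open>x\<close>. Its right half then carries almost the mass \<open>r\<close> (or the ball has
  unit scale), so every ball of radius \<open>r \<le> 1\<close> has mass at least \<open>(1 - o(1)) r powr h\<close>, and a packing
  by balls of diameters \<open>2 r\<close> has total at most \<open>2 + o(1)\<close>.

  Lower bound: a ball with centre in the last cylinder \<open>[1/(n+1), 1/n]\<close> and radius just below
  \<open>1/(n+1)\<close> has the empty gap \<open>[0, 1/(n+1)]\<close> as its left half, so its mass is only about half of its
  diameter. Copies of such balls in small cylinders exhaust almost all of the mass of any set, by a
  Vitali-type recursion that discards the branches covered by a chosen ball.

  Both estimates only need finite-level approximations of the measure.
\<close>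

section \<open>Packing measures\<close>

lemma packings_subset: "\<B> \<in> packings \<delta> E \<Longrightarrow> F \<subseteq> \<B> \<Longrightarrow> F \<in> packings \<delta> E"
  unfolding packings_def using countable_subset pairwise_subset[of disjnt \<B> F]
  by (auto simp: disjoint_def)

lemma sum_le_packing_sup:
  assumes "\<B> \<in> packings \<delta> E" "finite \<B>"
  shows "(\<Sum>B\<in>\<B>. ennreal (diameter B powr s)) \<le> packing_sup s \<delta> E"
  unfolding packing_sup_def using SUP_upper[OF assms(1), of "\<lambda>\<B>. \<Sum>\<^sub>\<infinity>B\<in>\<B>. ennreal (diameter B powr s)"] assms(2)
  by simp

lemma packing_sup_leI:
  assumes "\<And>\<B>. \<B> \<in> packings \<delta> E \<Longrightarrow> finite \<B> \<Longrightarrow> (\<Sum>B\<in>\<B>. ennreal (diameter B powr s)) \<le> c"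
  shows "packing_sup s \<delta> E \<le> c"
  unfolding packing_sup_def
proof (rule SUP_least)
  \<comment> \<open>A sum of nonnegative terms over a countable family is the supremum of its finite
    subsums, and every subfamily of a packing is again a packing.\<close>
  fix \<B> assume "\<B> \<in> packings \<delta> E"
  then show "(\<Sum>\<^sub>\<infinity>B\<in>\<B>. ennreal (diameter B powr s)) \<le> c"
    using assms packings_subset by (subst nonneg_infsum_complete) (auto intro!: SUP_least)
qed

lemma packings_diameter:
  assumes "\<B> \<in> packings \<delta> E" "B \<in> \<B>"
  shows "0 < diameter B" "diameter B \<le> 2 * \<delta>"
proof -
  obtain x r where "0 < r" "r \<le> \<delta>" "B = cball x r" using assms unfolding packings_def by blast
  then show "0 < diameter B" "diameter B \<le> 2 * \<delta>" using diameter_cball[of x r] by auto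
qed

lemma packing_sup_mono: "\<delta> \<le> \<delta>' \<Longrightarrow> packing_sup s \<delta> E \<le> packing_sup s \<delta>' E"
  unfolding packing_sup_def packings_def by (intro SUP_subset_mono) (auto, meson order_trans)

lemma packing_premeasure_empty: "packing_premeasure s {} = 0"
proof -
  have "packing_sup s \<delta> {} = 0" for \<delta>
    unfolding packing_sup_def packings_def by auto
  then show ?thesis by (simp add: packing_premeasure_def)
qed

lemma packing_measure_le_premeasure: "packing_measure s E \<le> packing_premeasure s E"
proof -
  define A where "A i = (if i = 0 then E else {})" for i :: nat
  have "packing_measure s E \<le> (\<Sum>i. packing_premeasure s (A i))"
    unfolding packing_measure_def by (intro INF_lower) (auto simp: A_def)
  also have "\<dots> = (\<Sum>i\<in>{0}. packing_premeasure s (A i))"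
    by (intro suminf_finite) (auto simp: A_def packing_premeasure_empty)
  finally show ?thesis by (simp add: A_def)
qed

lemma packing_premeasure_exponent_antimono:
  assumes "s \<le> t"
  shows "packing_premeasure t E \<le> packing_premeasure s E"
  unfolding packing_premeasure_def[of s]
proof (rule INF_greatest)
  fix \<delta> :: real assume \<delta>: "\<delta> \<in> {0<..}"
  \<comment> \<open>Capping the radius at 1/2 keeps all diameters at most 1, where powers decrease
    in the exponent.\<close>
  have "packing_premeasure t E \<le> packing_sup t (min \<delta> (1 / 2)) E"
    unfolding packing_premeasure_def using \<delta> by (intro INF_lower) auto
  also have "\<dots> \<le> packing_sup s (min \<delta> (1 / 2)) E"
  proof (rule packing_sup_leI)
    fix \<B> assume \<B>: "\<B> \<in> packings (min \<delta> (1 / 2)) E" "finite \<B>"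
    have "diameter B powr t \<le> diameter B powr s" if "B \<in> \<B>" for B
      using packings_diameter[OF \<B>(1) that] assms by (intro powr_mono') auto
    then have "(\<Sum>B\<in>\<B>. ennreal (diameter B powr t)) \<le> (\<Sum>B\<in>\<B>. ennreal (diameter B powr s))"
      by (intro sum_mono ennreal_leI)
    also have "\<dots> \<le> packing_sup s (min \<delta> (1 / 2)) E" by (rule sum_le_packing_sup[OF \<B>])
    finally show "(\<Sum>B\<in>\<B>. ennreal (diameter B powr t)) \<le> packing_sup s (min \<delta> (1 / 2)) E" .
  qed
  also have "\<dots> \<le> packing_sup s \<delta> E" by (rule packing_sup_mono) simp
  finally show "packing_premeasure t E \<le> packing_sup s \<delta> E" .
qed

lemma packing_measure_exponent_antimono:
  "s \<le> t \<Longrightarrow> packing_measure t E \<le> packing_measure s E"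
  unfolding packing_measure_def
  by (intro INF_mono') (auto intro!: suminf_le packing_premeasure_exponent_antimono)

text \<open>For radii at most \<open>\<delta>\<close>, each term with exponent \<open>s\<close> is
  at most \<open>(2 * \<delta>) powr (s - t)\<close> times the term with exponent \<open>t\<close>.
  The bound at \<open>t\<close> is uniform in \<open>\<delta>\<close>, so the premeasure at
  \<open>s\<close> vanishes as \<open>\<delta>\<close> tends to 0.\<close>

lemma packing_measure_eq_0:
  assumes fin: "packing_sup t 1 E \<le> ennreal C" and st: "t < s"
  shows "packing_measure s E = 0"
proof -
  have bound: "packing_premeasure s E \<le> ennreal ((2 * \<delta>) powr (s - t)) * ennreal C" if \<delta>: "0 < \<delta>" "\<delta> \<le> 1" for \<delta>
  proof -
    have "packing_premeasure s E \<le> packing_sup s \<delta> E"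
      unfolding packing_premeasure_def using \<delta> by (intro INF_lower) auto
    also have "\<dots> \<le> ennreal ((2 * \<delta>) powr (s - t)) * ennreal C"
    proof (rule packing_sup_leI)
      fix \<B> assume \<B>: "\<B> \<in> packings \<delta> E" "finite \<B>"
      have "diameter B powr s \<le> (2 * \<delta>) powr (s - t) * diameter B powr t" if "B \<in> \<B>" for B
      proof -
        have "diameter B powr s = diameter B powr (s - t) * diameter B powr t"
          by (simp flip: powr_add)
        then show ?thesis
          using packings_diameter[OF \<B>(1) that] st by (auto intro!: mult_right_mono powr_mono2)
      qed
      then have "(\<Sum>B\<in>\<B>. ennreal (diameter B powr s))
          \<le> (\<Sum>B\<in>\<B>. ennreal ((2 * \<delta>) powr (s - t)) * ennreal (diameter B powr t))"
        by (intro sum_mono) (auto intro: ennreal_leI simp flip: ennreal_mult)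
      also have "\<dots> = ennreal ((2 * \<delta>) powr (s - t)) * (\<Sum>B\<in>\<B>. ennreal (diameter B powr t))"
        by (rule sum_distrib_left[symmetric])
      also have "(\<Sum>B\<in>\<B>. ennreal (diameter B powr t)) \<le> ennreal C"
        using sum_le_packing_sup[OF \<B>, of t] packing_sup_mono[OF \<delta>(2), of t E] fin by (meson order_trans)
      finally show "(\<Sum>B\<in>\<B>. ennreal (diameter B powr s)) \<le> ennreal ((2 * \<delta>) powr (s - t)) * ennreal C"
        by (simp add: mult_left_mono)
    qed
    finally show ?thesis .
  qed
  have "((\<lambda>\<delta>. (2 * \<delta>) powr (s - t)) \<longlongrightarrow> (2 * 0) powr (s - t)) (at_right (0 :: real))"
    using st by (intro tendsto_powr' tendsto_intros) (auto simp: eventually_at_filter)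
  \<comment> \<open>Since \<open>ennreal C\<close> is 0 for negative \<open>C\<close>, it is
    replaced by the nonnegative number \<open>max C 0\<close>, for which \<open>ennreal\<close> is
    multiplicative.\<close>
  then have "((\<lambda>\<delta>. ennreal ((2 * \<delta>) powr (s - t) * max C 0)) \<longlongrightarrow> ennreal ((2 * 0) powr (s - t) * max C 0)) (at_right 0)"
    by (intro tendsto_ennrealI tendsto_mult tendsto_const)
  then have "((\<lambda>\<delta>. ennreal ((2 * \<delta>) powr (s - t) * max C 0)) \<longlongrightarrow> 0) (at_right 0)" by simp
  moreover have "\<forall>\<^sub>F \<delta> in at_right 0. packing_premeasure s E \<le> ennreal ((2 * \<delta>) powr (s - t) * max C 0)"
    unfolding eventually_at_right_field
  proof (intro exI[of _ 1] conjI allI impI)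
    fix \<delta> :: real assume "0 < \<delta>" "\<delta> < 1"
    then have "packing_premeasure s E \<le> ennreal ((2 * \<delta>) powr (s - t)) * ennreal C" using bound by auto
    also have "ennreal C = ennreal (max C 0)" by (simp add: max_def ennreal_neg)
    finally show "packing_premeasure s E \<le> ennreal ((2 * \<delta>) powr (s - t) * max C 0)"
      by (simp add: ennreal_mult)
  qed simp
  ultimately have "packing_premeasure s E \<le> 0" by (rule tendsto_lowerbound) simp
  then show ?thesis using packing_measure_le_premeasure[of s E] by simp
qed

text \<open>A finite packing supremum at \<open>t\<close> annihilates every larger exponent, and
  positivity at \<open>t\<close> is inherited by every smaller one. The null exponents therefore
  form exactly the ray \<open>{t<..}\<close>.\<close>

lemma packing_dim_eqI:
  assumes "0 \<le> t" "packing_sup t 1 E \<le> ennreal C" "packing_measure t E > 0"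
  shows "packing_dim E = t"
proof -
  have "{s. 0 \<le> s \<and> packing_measure s E = 0} = {t<..}"
  proof (intro set_eqI)
    fix s
    show "s \<in> {s. 0 \<le> s \<and> packing_measure s E = 0} \<longleftrightarrow> s \<in> {t<..}"
      using packing_measure_eq_0[OF assms(2), of s] packing_measure_exponent_antimono[of s t E] assms(1,3)
      by (cases "t < s") (auto simp: not_less)
  qed
  then show ?thesis by (simp add: packing_dim_def)
qed

section \<open>The affine branches\<close>

definition len :: "nat \<Rightarrow> real" where
  "len k = 1 / (real k * (real k + 1))"

text \<open>The affine formula of \<open>inv_branch k\<close>, extended to the whole line. On the
  line it is a genuine two-sided inverse of \<open>branch k\<close>, so that preimages and images of
  balls need no case distinction at the ends of the unit interval.\<close>

definition contr :: "nat \<Rightarrow> real \<Rightarrow> real" where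
  "contr k y = 1 / real k - len k * y"

lemma len_pos: "k \<ge> 1 \<Longrightarrow> 0 < len k"
  by (simp add: len_def)

lemma len_eq_diff: "k \<ge> 1 \<Longrightarrow> len k = 1 / real k - 1 / (real k + 1)"
  by (simp add: len_def field_simps)

lemma len_antimono: "1 \<le> j \<Longrightarrow> j \<le> k \<Longrightarrow> len k \<le> len j"
  unfolding len_def by (intro divide_left_mono mult_mono) auto

lemma len_le_half: "k \<ge> 1 \<Longrightarrow> len k \<le> 1 / 2"
  using len_antimono[of 1 k] by (simp add: len_def)

lemma len_le_triple_Suc:
  assumes "k \<ge> 1"
  shows "len k \<le> 3 * len (Suc k)"
proof -
  have "(real k + 2) * (real k + 1) \<le> 3 * real k * (real k + 1)"
    using assms by (intro mult_right_mono) auto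
  then have "3 / (3 * real k * (real k + 1)) \<le> 3 / ((real k + 2) * (real k + 1))"
    using assms by (intro divide_left_mono) auto
  moreover have "len k = 3 / (3 * real k * (real k + 1))" by (simp add: len_def)
  moreover have "3 * len (Suc k) = 3 / ((real k + 2) * (real k + 1))"
    by (simp add: len_def add.commute mult.commute)
  ultimately show ?thesis by simp
qed

text \<open>The worst case is 1/2 + 1/6. The bound serves as the contraction factor of the error
  recursion in \<open>inner_mass_coarse\<close>.\<close>

lemma len_add_le:
  assumes "1 \<le> i" "1 \<le> j" "i \<noteq> j"
  shows "len i + len j \<le> 2 / 3"
proof -
  have *: "len i + len j \<le> 2 / 3" if "1 \<le> i" "i < j" for i j
    proof -
    have "len i \<le> len 1" "len j \<le> len 2" using that by (intro len_antimono; simp)+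
    moreover have "len 1 = 1 / 2" "len 2 = 1 / 6" by (simp_all add: len_def)
    ultimately show ?thesis by linarith
  qed
  show ?thesis
  proof (cases "i < j")
    case False
    with assms show ?thesis using *[of j i] by simp
  qed (use * assms in auto)
qed

lemma sum_len:
  assumes "1 \<le> j" "j \<le> Suc n"
  shows "(\<Sum>k = j..n. len k) = 1 / real j - 1 / (real n + 1)"
  using assms(2)
proof (induction n)
  case 0
  with assms(1) have "j = 1" by simp
  then show ?case by simp
next
  case (Suc n)
  show ?case
  proof (cases "j = Suc (Suc n)")
    case False
    with Suc show ?thesis by (simp add: len_eq_diff add.commute)
  qed (simp add: add.commute)
qed

lemma len_branch: "k \<ge> 1 \<Longrightarrow> len k * branch k x = 1 / real k - x"
  by (simp add: len_def branch_def)

lemma branch_eq: "k \<ge> 1 \<Longrightarrow> branch k x = (1 / real k - x) / len k"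
  using len_branch[of k x] len_pos[of k] by (simp add: field_simps)

lemma contr_branch: "k \<ge> 1 \<Longrightarrow> contr k (branch k x) = x"
  by (simp add: contr_def len_branch)

lemma branch_contr: "k \<ge> 1 \<Longrightarrow> branch k (contr k y) = y"
  using len_pos[of k] by (simp add: branch_eq contr_def)

lemma branch_mono_iff: "k \<ge> 1 \<Longrightarrow> branch k x \<le> branch k y \<longleftrightarrow> y \<le> x"
  using len_pos[of k] by (simp add: branch_eq divide_le_cancel)

lemma branch_le_0_iff: "k \<ge> 1 \<Longrightarrow> branch k x \<le> 0 \<longleftrightarrow> 1 / real k \<le> x"
  using branch_mono_iff[of k x "1 / real k"] branch_endpoints(2)[of k] by simp

lemma branch_ge_1_iff: "k \<ge> 1 \<Longrightarrow> 1 \<le> branch k x \<longleftrightarrow> x \<le> 1 / (real k + 1)"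
  using branch_mono_iff[of k "1 / (real k + 1)" x] branch_endpoints(1)[of k] by simp

lemma inv_branch_eq_contr: "k \<ge> 1 \<Longrightarrow> y \<in> {0..1} \<Longrightarrow> inv_branch k y = contr k y"
  by (simp add: inv_branch_eq contr_def len_def)

lemma contr_unit:
  assumes "k \<ge> 1" "y \<in> {0..1}"
  shows "contr k y \<in> {1 / (real k + 1)..1 / real k}"
proof -
  have "0 \<le> len k * y" "len k * y \<le> len k"
    using assms len_pos[of k] by (auto intro: mult_left_le)
  then show ?thesis using assms len_eq_diff[of k] by (simp add: contr_def)
qed

lemma contr_in_unit: "k \<ge> 1 \<Longrightarrow> y \<in> {0..1} \<Longrightarrow> contr k y \<in> {0..1}"
  using contr_unit[of k y] by (auto intro: order_trans[of _ "1 / real k"] order_trans[of _ "1 / (real k + 1)"])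

section \<open>Coding of the limit set by words\<close>

lemma foldr_contr_in_unit:
  "set q \<subseteq> {1..n} \<Longrightarrow> y \<in> {0..1} \<Longrightarrow> foldr contr q y \<in> {0..1}"
proof (induction q)
  case (Cons k q)
  then show ?case using contr_in_unit[of k "foldr contr q y"] by auto
qed auto

lemma foldr_inv_branch:
  "set q \<subseteq> {1..n} \<Longrightarrow> y \<in> {0..1} \<Longrightarrow> foldr inv_branch q y = foldr contr q y"
proof (induction q)
  case (Cons k q)
  then show ?case
    using inv_branch_eq_contr[of k "foldr contr q y"] foldr_contr_in_unit[of q n y] by auto
qed auto

lemma mem_limit_set:
  "x \<in> limit_set n \<longleftrightarrow>
     (\<forall>l\<ge>1. \<exists>q. length q = l \<and> set q \<subseteq> {1..n} \<and> x \<in> foldr contr q ` {0..1})"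
proof -
  have "foldr inv_branch q ` {0..1} = foldr contr q ` {0..1}" if "set q \<subseteq> {1..n}" for q
    using foldr_inv_branch[OF that] by (intro image_cong) auto
  then show ?thesis unfolding limit_set_def by fastforce
qed

text \<open>Each level supplies a word, but words of different levels need not be compatible. On the
  half-open interval \<open>(0, 1]\<close> the branches have disjoint images, so the first letter
  and the remaining point do not depend on the level.\<close>

lemma limit_set_step:
  assumes "x \<in> limit_set n"
  shows "\<exists>k\<in>{1..n}. \<exists>y\<in>limit_set n. y \<in> {0..1} \<and> x = contr k y"
proof -
  have first: "\<exists>k q z. k \<in> {1..n} \<and> length q = l \<and> set q \<subseteq> {1..n} \<and> z \<in> foldr contr q ` {0..1}
      \<and> x = contr k z \<and> 0 < z \<and> z \<le> 1" if l: "l \<ge> 1" for l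
  proof -
    \<comment> \<open>One letter more than \<open>l\<close> is taken, so that the remainder lies in
      a first-level cylinder and is strictly positive.\<close>
    obtain q where q: "length q = Suc l" "set q \<subseteq> {1..n}" "x \<in> foldr contr q ` {0..1}"
      using assms l unfolding mem_limit_set by (meson le_SucI)
    then obtain k q' where kq: "q = k # q'" "length q' = l" by (auto simp: length_Suc_conv)
    then obtain j q'' where jq: "q' = j # q''" using l by (cases q') auto
    obtain y where y: "y \<in> {0..1}" "x = contr k (foldr contr q' y)" using q kq by auto
    have u: "foldr contr q'' y \<in> {0..1}" using foldr_contr_in_unit[of q'' n y] q kq jq y by auto
    have "foldr contr q' y \<in> {1 / (real j + 1)..1 / real j}"
      using contr_unit[OF _ u, of j] q kq jq by auto
    moreover have "1 / real j \<le> 1" "0 < 1 / (real j + 1)" using q kq jq by auto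
    ultimately have "0 < foldr contr q' y" "foldr contr q' y \<le> 1"
      by (meson atLeastAtMost_iff less_le_trans order_trans)+
    with y q kq show ?thesis by (intro exI[of _ k] exI[of _ q'] exI[of _ "foldr contr q' y"]) auto
  qed
  have uniq: "k = k'" if "k \<ge> 1" "k' \<ge> 1" "0 < z" "z \<le> 1" "0 < z'" "z' \<le> 1" "contr k z = contr k' z'"
    for k k' z z'
  proof -
    have *: False if "k < k'" "1 \<le> k" "z \<le> 1" "0 < z'" "contr k z = contr k' z'" "0 < z" for k k' z z'
    proof -
      have "contr k' z' < 1 / real k'" using len_pos[of k'] that by (simp add: contr_def)
      also have "\<dots> \<le> 1 / (real k + 1)" using that by (intro divide_left_mono) auto
      also have "\<dots> \<le> contr k z" using contr_unit[of k z] that by auto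
      finally show False using that by simp
    qed
    show ?thesis using *[of k k' z z'] *[of k' k z' z] that by (metis linorder_neqE_nat)
  qed
  obtain k q z where k: "k \<in> {1..n}" "x = contr k z" "0 < z" "z \<le> 1" using first[of 1] by auto
  have "z \<in> limit_set n"
    unfolding mem_limit_set
  proof (intro allI impI)
    fix l :: nat assume "l \<ge> 1"
    then obtain k' q' z' where *: "k' \<in> {1..n}" "length q' = l" "set q' \<subseteq> {1..n}"
      "z' \<in> foldr contr q' ` {0..1}" "x = contr k' z'" "0 < z'" "z' \<le> 1" using first by meson
    then have "k = k'" using uniq[of k k' z z'] k by auto
    then have "z = z'" using * k branch_contr[of k z] branch_contr[of k z'] by auto
    then show "\<exists>q. length q = l \<and> set q \<subseteq> {1..n} \<and> z \<in> foldr contr q ` {0..1}" using * by auto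
  qed
  with k show ?thesis by (intro bexI[of _ k] bexI[of _ z]) auto
qed

section \<open>Telescoping and the cells that contain given points\<close>

lemma sum_diff_Suc: "(\<Sum>k = 1..m. f k - f (Suc k)) = f 1 - (f (Suc m) :: real)"
  by (induction m) auto

lemma open_interval_index_unique:
  "\<exists>i. \<forall>k\<ge>1. x \<in> {1 / (real k + 1)<..<1 / real k} \<longrightarrow> k = i"
proof -
  have *: False if "1 \<le> k" "k < k'" "x \<in> {1 / (real k + 1)<..<1 / real k}"
    "x \<in> {1 / (real k' + 1)<..<1 / real k'}" for k k'
  proof -
    have "1 / real k' \<le> 1 / (real k + 1)" using that by (intro divide_left_mono) auto
    then show False using that by auto
  qed
  have "k = k'" if "1 \<le> k" "1 \<le> k'" "x \<in> {1 / (real k + 1)<..<1 / real k}"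
    "x \<in> {1 / (real k' + 1)<..<1 / real k'}" for k k'
    using *[of k k'] *[of k' k] that by (meson linorder_neqE_nat)
  then show ?thesis by meson
qed

lemma sum_len_pair_le:
  assumes "X \<subseteq> {i, j}" "\<forall>k\<in>X. 1 \<le> k"
  shows "sum len X \<le> 2 / 3"
proof -
  have "X = {} \<or> X = {i} \<or> X = {j} \<or> (X = {i, j} \<and> i \<noteq> j)" using assms(1) by blast
  then show ?thesis
  proof (elim disjE)
    assume "X = {i}"
    then show ?thesis using assms len_le_half[of i] by simp
  next
    assume "X = {j}"
    then show ?thesis using assms len_le_half[of j] by simp
  next
    assume "X = {i, j} \<and> i \<noteq> j"
    then show ?thesis using assms len_add_le[of i j] by simp
  qed auto
qed

section \<open>Images of balls and of finite packings under the branches\<close>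

lemma contr_diff: "contr k x - contr k y = len k * (y - x)"
  by (simp add: contr_def algebra_simps)

lemma inj_contr: "k \<ge> 1 \<Longrightarrow> inj (contr k)"
  by (rule inj_on_inverseI[of _ "branch k"]) (simp add: branch_contr)

lemma contr_image_cball:
  assumes "k \<ge> 1"
  shows "contr k ` cball x r = cball (contr k x) (len k * r)"
proof -
  have *: "dist (contr k x) (contr k y) = len k * dist x y" for y
    using len_pos[OF assms] by (simp add: dist_real_def contr_diff abs_mult abs_minus_commute)
  have mem: "contr k y \<in> cball (contr k x) (len k * r) \<longleftrightarrow> y \<in> cball x r" for y
    using len_pos[OF assms] by (simp add: *)
  show ?thesis
  proof (intro subset_antisym subsetI)
    fix z assume "z \<in> cball (contr k x) (len k * r)"
    then have "branch k z \<in> cball x r" using mem[of "branch k z"] contr_branch[OF assms] by simp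
    then show "z \<in> contr k ` cball x r" using contr_branch[OF assms, of z] by (metis image_eqI)
  qed (use mem in blast)
qed

definition cell :: "nat \<Rightarrow> real set" where
  "cell k = {1 / (real k + 1)<..<1 / real k}"

lemma cell_disjoint: "1 \<le> k \<Longrightarrow> 1 \<le> k' \<Longrightarrow> k \<noteq> k' \<Longrightarrow> cell k \<inter> cell k' = {}"
  using open_interval_index_unique unfolding cell_def disjoint_iff by metis

lemma contr_open_unit:
  assumes "k \<ge> 1"
  shows "contr k ` {0<..<1} \<subseteq> cell k"
proof
  fix z assume "z \<in> contr k ` {0<..<1}"
  then obtain y where y: "0 < y" "y < 1" "z = contr k y" by auto
  then have "0 < len k * y" "len k * y < len k" using len_pos[OF assms] by auto
  then show "z \<in> cell k" using y len_eq_diff[OF assms] by (simp add: cell_def contr_def)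
qed

lemma cell_subset_unit: "k \<ge> 1 \<Longrightarrow> cell k \<subseteq> {0<..<1}"
proof -
  assume "k \<ge> 1"
  then have "0 < 1 / (real k + 1)" "1 / real k \<le> 1" by auto
  then show "cell k \<subseteq> {0<..<1}" unfolding cell_def by (intro subsetI) (simp only: greaterThanLessThan_iff, linarith)
qed

text \<open>The balls are kept inside the open unit interval because neighbouring closed cylinders
  share an endpoint. Images under different branches then fall into disjoint open cells.\<close>

definition fin_packing :: "real \<Rightarrow> real set \<Rightarrow> real set set \<Rightarrow> bool" where
  "fin_packing R A \<B> \<longleftrightarrow> finite \<B> \<and> disjoint \<B> \<and>
     (\<forall>B\<in>\<B>. B \<subseteq> {0<..<1} \<and> (\<exists>x\<in>A. \<exists>r. 0 < r \<and> r \<le> R \<and> B = cball x r))"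

lemma fin_packing_mono: "fin_packing R A \<B> \<Longrightarrow> R \<le> R' \<Longrightarrow> fin_packing R' A \<B>"
  unfolding fin_packing_def by fastforce

lemma fin_packing_imp_packing: "fin_packing R A \<B> \<Longrightarrow> R \<le> \<delta> \<Longrightarrow> \<B> \<in> packings \<delta> A"
  using fin_packing_mono[of R A \<B> \<delta>] by (simp add: fin_packing_def packings_def countable_finite)

text \<open>This is the self-similarity step. Packings of the pullbacks of \<open>A\<close> are
  mapped back into different cells and united. Radii at least halve, and the sums of powers scale
  with the weights.\<close>

lemma fin_packing_UN_contr:
  assumes S: "S \<subseteq> {1..n}"
    and P: "\<And>k. k \<in> S \<Longrightarrow> fin_packing R (contr k -` A) (P k)"
  defines "\<C> \<equiv> \<Union>k\<in>S. (`) (contr k) ` P k"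
  shows "fin_packing (R / 2) A \<C>"
    and "\<forall>C\<in>\<C>. \<exists>k\<in>S. C \<subseteq> cell k"
    and "(\<Sum>C\<in>\<C>. diameter C powr h) = (\<Sum>k\<in>S. len k powr h * (\<Sum>B\<in>P k. diameter B powr h))"
proof -
  have k1: "k \<ge> 1" if "k \<in> S" for k using that S by auto
  have finS: "finite S" using S finite_subset by blast
  have sub: "contr k ` B \<subseteq> cell k" if "k \<in> S" "B \<in> P k" for k B
    using contr_open_unit[OF k1[OF that(1)]] P[OF that(1)] that(2) unfolding fin_packing_def by blast
  have elem: thesis if "C \<in> \<C>" "\<And>k B. k \<in> S \<Longrightarrow> B \<in> P k \<Longrightarrow> C = contr k ` B \<Longrightarrow> thesis" for C thesis
    using that unfolding \<C>_def by auto
  show cell: "\<forall>C\<in>\<C>. \<exists>k\<in>S. C \<subseteq> cell k"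
  proof
    fix C assume "C \<in> \<C>"
    then obtain k B where "k \<in> S" "B \<in> P k" "C = contr k ` B" by (rule elem)
    then show "\<exists>k\<in>S. C \<subseteq> cell k" using sub by (intro bexI[of _ k]) simp_all
  qed
  have P_ball: "\<exists>x r. x \<in> contr k -` A \<and> 0 < r \<and> r \<le> R \<and> B = cball x r" if kB: "k \<in> S" "B \<in> P k" for k B
  proof -
    have "\<exists>x\<in>contr k -` A. \<exists>r. 0 < r \<and> r \<le> R \<and> B = cball x r"
      using P[OF kB(1)] kB(2) by (simp add: fin_packing_def)
    then show ?thesis by (simp only: Bex_def) blast
  qed
  have ne: "B \<noteq> {}" if kB: "k \<in> S" "B \<in> P k" for k B
  proof -
    obtain x r where "0 < r" "B = cball x r" using P_ball[OF kB] by blast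
    then show ?thesis by simp
  qed
  have disj: "contr k ` B \<inter> contr k' ` B' = {}"
    if "k \<in> S" "k' \<in> S" "B \<in> P k" "B' \<in> P k'" "contr k ` B \<noteq> contr k' ` B'" for k k' B B'
  proof (cases "k = k'")
    case True
    have "disjoint (P k)" using P[OF that(1)] by (simp add: fin_packing_def)
    then have "B \<inter> B' = {}" using that(3,4,5) True by (metis disjointD)
    then show ?thesis using True image_Int[OF inj_contr[OF k1[OF that(1)]], of B B'] by simp
  next
    case False
    then have "cell k \<inter> cell k' = {}" using cell_disjoint[of k k'] k1 that(1,2) by blast
    then show ?thesis using sub[OF that(1,3)] sub[OF that(2,4)] by blast
  qed
  have ball: "\<exists>x\<in>A. \<exists>r. 0 < r \<and> r \<le> R / 2 \<and> contr k ` B = cball x r" if kB: "k \<in> S" "B \<in> P k" for k B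
  proof -
    obtain x r where xr: "x \<in> contr k -` A" "0 < r" "r \<le> R" "B = cball x r"
      using P_ball[OF kB] by blast
    have "len k * r \<le> 1 / 2 * R"
      using xr len_le_half[OF k1[OF kB(1)]] len_pos[OF k1[OF kB(1)]] by (intro mult_mono) auto
    then show ?thesis
      using xr contr_image_cball[OF k1[OF kB(1)]] len_pos[OF k1[OF kB(1)]]
      by (intro bexI[of _ "contr k x"] exI[of _ "len k * r"]) auto
  qed
  show "fin_packing (R / 2) A \<C>"
    unfolding fin_packing_def
  proof (intro conjI ballI)
    show "finite \<C>" unfolding \<C>_def using finS P by (auto simp: fin_packing_def)
    show "disjoint \<C>"
      unfolding disjoint_def
    proof (intro ballI impI)
      fix C C' assume C: "C \<in> \<C>" "C' \<in> \<C>" "C \<noteq> C'"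
      obtain k B where "k \<in> S" "B \<in> P k" "C = contr k ` B" using C(1) by (rule elem)
      moreover obtain k' B' where "k' \<in> S" "B' \<in> P k'" "C' = contr k' ` B'" using C(2) by (rule elem)
      ultimately show "C \<inter> C' = {}" using disj C(3) by simp
    qed
    fix C assume "C \<in> \<C>"
    then obtain k B where kB: "k \<in> S" "B \<in> P k" "C = contr k ` B" by (rule elem)
    show "C \<subseteq> {0<..<1}" using sub[OF kB(1,2)] cell_subset_unit[OF k1[OF kB(1)]] kB(3) by simp
    show "\<exists>x\<in>A. \<exists>r. 0 < r \<and> r \<le> R / 2 \<and> C = cball x r" using ball[OF kB(1,2)] kB(3) by simp
  qed
  have "(\<Sum>C\<in>\<C>. diameter C powr h) = (\<Sum>k\<in>S. \<Sum>C\<in>(`) (contr k) ` P k. diameter C powr h)"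
    unfolding \<C>_def
  proof (rule sum.UNION_disjoint)
    show "\<forall>k\<in>S. \<forall>k'\<in>S. k \<noteq> k' \<longrightarrow> (`) (contr k) ` P k \<inter> (`) (contr k') ` P k' = {}"
    proof (intro ballI impI)
      fix k k' assume kk: "k \<in> S" "k' \<in> S" "k \<noteq> k'"
      show "(`) (contr k) ` P k \<inter> (`) (contr k') ` P k' = {}"
      proof (rule equals0I)
        fix C assume "C \<in> (`) (contr k) ` P k \<inter> (`) (contr k') ` P k'"
        then obtain B B' where B: "B \<in> P k" "B' \<in> P k'" "C = contr k ` B" "C = contr k' ` B'" by auto
        have "C \<subseteq> cell k" using sub[OF kk(1) B(1)] B(3) by simp
        moreover have "C \<subseteq> cell k'" using sub[OF kk(2) B(2)] B(4) by simp
        moreover have "C \<noteq> {}" using ne[OF kk(1) B(1)] B(3) by simp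
        ultimately show False using cell_disjoint[OF k1[OF kk(1)] k1[OF kk(2)] kk(3)] by blast
      qed
    qed
  qed (use finS P in \<open>auto simp: fin_packing_def\<close>)
  also have "\<dots> = (\<Sum>k\<in>S. len k powr h * (\<Sum>B\<in>P k. diameter B powr h))"
  proof (rule sum.cong)
    fix k assume k: "k \<in> S"
    have diam: "diameter (contr k ` B) powr h = len k powr h * diameter B powr h" if B: "B \<in> P k" for B
    proof -
      obtain x r where xr: "0 < r" "B = cball x r" using P_ball[OF k B] by blast
      then have "diameter B = 2 * r" "diameter (contr k ` B) = len k * (2 * r)"
        using len_pos[OF k1[OF k]] contr_image_cball[OF k1[OF k], of x r]
          diameter_cball[of "contr k x" "len k * r"] diameter_cball[of x r]
        by (auto simp: mult_less_0_iff)
      then show ?thesis using xr len_pos[OF k1[OF k]] by (simp add: powr_mult)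
    qed
    have "inj_on ((`) (contr k)) (P k)" using inj_contr[OF k1[OF k]] by (intro inj_on_image) (simp add: inj_on_def)
    then show "(\<Sum>C\<in>(`) (contr k) ` P k. diameter C powr h) = len k powr h * (\<Sum>B\<in>P k. diameter B powr h)"
      using diam by (simp add: sum.reindex sum_distrib_left)
  qed simp
  finally show "(\<Sum>C\<in>\<C>. diameter C powr h) = (\<Sum>k\<in>S. len k powr h * (\<Sum>B\<in>P k. diameter B powr h))" .
qed

text \<open>This is \<open>(n (n + 1)) powr (2 / n)\<close>, which dominates
  \<open>distortion\<close> once \<open>1 - h\<close> is bounded by \<open>2 / n\<close>. It depends
  on \<open>n\<close> only and tends to 1.\<close>

definition distortion_bound :: "nat \<Rightarrow> real" where
  "distortion_bound n = exp (2 * ln (real n * (real n + 1)) / real n)"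

section \<open>Lower density of balls\<close>

text \<open>The equation \<open>moran\<close> turns the weights into a probability vector. With
  \<open>h\<close> as a parameter, all estimates are available before \<open>h\<close> is identified
  with the packing dimension.\<close>

locale luroth_ifs =
  fixes n :: nat and h :: real
  assumes h_nonneg: "0 \<le> h" and h_le_1: "h \<le> 1"
    and moran: "(\<Sum>k = 1..n. len k powr h) = 1"
begin

abbreviation wt :: "nat \<Rightarrow> real" where "wt k \<equiv> len k powr h"

lemma len_le_wt: "k \<ge> 1 \<Longrightarrow> len k \<le> wt k"
  using powr_mono'[of h 1 "len k"] len_pos[of k] len_le_half[of k] h_le_1 by simp

text \<open>
  The total weight of the level-\<open>l\<close> cylinders contained in \<open>[s, t]\<close>; the endpoints are swapped in the
  recursion because the branches decrease.
\<close>
primrec inner_mass :: "nat \<Rightarrow> real \<Rightarrow> real \<Rightarrow> real" where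
  "inner_mass 0 s t = (if s \<le> 0 \<and> 1 \<le> t then 1 else 0)"
| "inner_mass (Suc l) s t = (\<Sum>k = 1..n. wt k * inner_mass l (branch k t) (branch k s))"

lemma inner_mass_nonneg: "0 \<le> inner_mass l s t"
  by (induction l arbitrary: s t) (auto intro!: sum_nonneg)

lemma inner_mass_mono: "s' \<le> s \<Longrightarrow> t \<le> t' \<Longrightarrow> inner_mass l s t \<le> inner_mass l s' t'"
proof (induction l arbitrary: s t s' t')
  case (Suc l)
  then show ?case by (auto intro!: sum_mono mult_left_mono simp: branch_mono_iff)
qed auto

lemma inner_mass_full: "s \<le> 0 \<Longrightarrow> 1 \<le> t \<Longrightarrow> inner_mass l s t = 1"
proof (induction l arbitrary: s t)
  case (Suc l)
  have "inner_mass l (branch k t) (branch k s) = 1" if "k \<in> {1..n}" for k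
  proof (rule Suc.IH)
    have "1 / real k \<le> 1" using that by simp
    then show "branch k t \<le> 0" using that Suc.prems branch_le_0_iff[of k t] by auto
    have "0 \<le> 1 / (real k + 1)" by simp
    then have "s \<le> 1 / (real k + 1)" using Suc.prems(1) by linarith
    then show "1 \<le> branch k s" using that branch_ge_1_iff[of k s] by auto
  qed
  then show ?case using moran by simp
qed auto

lemma inner_mass_le_Suc: "inner_mass l s t \<le> inner_mass (Suc l) s t"
proof (induction l arbitrary: s t)
  case 0
  show ?case
    using inner_mass_full[of s t "Suc 0"] inner_mass_nonneg[of "Suc 0" s t]
    by (simp del: inner_mass.simps(2))
next
  case (Suc l)
  show ?case
    unfolding inner_mass.simps(2)[of "Suc l"] by (subst inner_mass.simps(2)) (intro sum_mono mult_left_mono Suc.IH; simp)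
qed

lemma inner_mass_mono_level: "l \<le> l' \<Longrightarrow> inner_mass l s t \<le> inner_mass l' s t"
  by (rule lift_Suc_mono_le[of "\<lambda>l. inner_mass l s t"]) (auto simp: inner_mass_le_Suc simp del: inner_mass.simps)

text \<open>A cylinder is contained in at most one of several disjoint intervals. At level 0 two
  intervals containing the unit interval would share the point 0, and preimages under the branches
  preserve disjointness.\<close>

lemma inner_mass_disjoint_sum_le_1:
  assumes "finite F" "disjoint_family_on (\<lambda>i. {s i..t i}) F"
  shows "(\<Sum>i\<in>F. inner_mass l (s i) (t i)) \<le> 1"
  using assms(2)
proof (induction l arbitrary: s t)
  case 0
  let ?G = "{i\<in>F. s i \<le> 0 \<and> 1 \<le> t i}"
  have "i = j" if "i \<in> ?G" "j \<in> ?G" for i j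
  proof (rule ccontr)
    assume "i \<noteq> j"
    then have "{s i..t i} \<inter> {s j..t j} = {}" using 0[unfolded disjoint_family_on_def] that by blast
    moreover have "0 \<in> {s i..t i} \<inter> {s j..t j}" using that by auto
    ultimately show False by blast
  qed
  then have "card ?G \<le> 1" using assms(1) by (subst One_nat_def, subst card_le_Suc0_iff_eq) auto
  moreover have "(\<Sum>i\<in>F. inner_mass 0 (s i) (t i)) = real (card ?G)"
    using assms(1) by (simp add: sum.If_cases Int_def)
  ultimately show ?case by linarith
next
  case (Suc l)
  have "(\<Sum>i\<in>F. inner_mass (Suc l) (s i) (t i))
      = (\<Sum>k = 1..n. wt k * (\<Sum>i\<in>F. inner_mass l (branch k (t i)) (branch k (s i))))"
    by (simp add: sum_distrib_left sum.swap[of _ F])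
  also have "\<dots> \<le> (\<Sum>k = 1..n. wt k * 1)"
  proof (intro sum_mono mult_left_mono Suc.IH)
    fix k assume "k \<in> {1..n}"
    then have k: "k \<ge> 1" by simp
    have "z \<in> {branch k (t i)..branch k (s i)} \<longleftrightarrow> contr k z \<in> {s i..t i}" for z i
      using branch_mono_iff[OF k, of "t i" "contr k z"] branch_mono_iff[OF k, of "contr k z" "s i"]
      by (auto simp: branch_contr[OF k])
    then show "disjoint_family_on (\<lambda>i. {branch k (t i)..branch k (s i)}) F"
      using Suc.prems unfolding disjoint_family_on_def by blast
  qed auto
  also have "\<dots> = 1" using moran by simp
  finally show ?case .
qed

text \<open>The difference of the two clamped values is the length of the part of
  \<open>[s, t]\<close> in the \<open>k\<close>-th cylinder. A cylinder that is covered or missed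
  causes no error. Only one with an endpoint of \<open>[s, t]\<close> in its interior inherits the
  error \<open>E\<close>, scaled by \<open>len k\<close>.\<close>

lemma wt_inner_mass_ge:
  assumes IH: "\<And>s t. 0 \<le> s \<Longrightarrow> s \<le> t \<Longrightarrow> t \<le> 1 \<Longrightarrow> t - s - E \<le> inner_mass l s t"
    and E: "0 \<le> E" and st: "s \<le> t" and k: "k \<ge> 1"
  shows "min t (max s (1 / real k)) - min t (max s (1 / (real k + 1))) -
      (if s \<in> {1 / (real k + 1)<..<1 / real k} \<or> t \<in> {1 / (real k + 1)<..<1 / real k}
       then len k * E else 0)
    \<le> wt k * inner_mass l (branch k t) (branch k s)" (is "?lhs \<le> _")
proof -
  define u v p q where "u = 1 / (real k + 1)" "v = 1 / real k"
    "p = min t (max s v)" "q = min t (max s u)"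
  note defs = this
  have uv: "u < v" "len k = v - u" using k len_pos[of k] len_eq_diff[of k] by (auto simp: defs)
  have "?lhs \<le> len k * inner_mass l (branch k t) (branch k s)"
  proof (cases "s \<in> {u<..<v} \<or> t \<in> {u<..<v}")
    case False
    show ?thesis
    proof (cases "s \<ge> v \<or> t \<le> u")
      case True
      then have "p = q" using uv st by (auto simp: defs)
      then show ?thesis
        using False inner_mass_nonneg[of l "branch k t" "branch k s"] len_pos[OF k]
        by (auto simp: defs intro: mult_nonneg_nonneg)
    next
      case *: False
      then have "s \<le> u" "v \<le> t" using False by auto
      then have "inner_mass l (branch k t) (branch k s) = 1" "p = v" "q = u"
        using branch_le_0_iff[OF k, of t] branch_ge_1_iff[OF k, of s] uv
        by (auto simp: defs intro!: inner_mass_full)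
      then show ?thesis using False uv by (auto simp: defs)
    qed
  next
    case True
    then have pq: "u \<le> q" "q \<le> p" "p \<le> v" "p \<le> t" "s \<le> q" using uv st by (auto simp: defs)
    have "branch k q - branch k p - E \<le> inner_mass l (branch k p) (branch k q)"
    proof (rule IH)
      show "0 \<le> branch k p" using branch_mono_iff[OF k, of "1 / real k" p] branch_endpoints(2)[OF k] pq
        by (simp add: defs)
      show "branch k q \<le> 1" using branch_mono_iff[OF k, of q "1 / (real k + 1)"] branch_endpoints(1)[OF k] pq
        by (simp add: defs)
      show "branch k p \<le> branch k q" using pq by (simp add: branch_mono_iff[OF k])
    qed
    also have "\<dots> \<le> inner_mass l (branch k t) (branch k s)"
      using pq by (intro inner_mass_mono) (auto simp: branch_mono_iff[OF k])
    finally have "len k * (branch k q - branch k p - E) \<le> len k * inner_mass l (branch k t) (branch k s)"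
      using len_pos[OF k] by (intro mult_left_mono) auto
    then show ?thesis using True len_branch[OF k, of p] len_branch[OF k, of q]
      by (auto simp: right_diff_distrib defs)
  qed
  also have "\<dots> \<le> wt k * inner_mass l (branch k t) (branch k s)"
    using len_le_wt[OF k] inner_mass_nonneg by (intro mult_right_mono) auto
  finally show ?thesis .
qed

text \<open>The clamped lengths telescope over the branches. What is lost is the part of
  \<open>[s, t]\<close> in the gap below \<open>1/(n+1)\<close>, together with the scaled error of
  the at most two cells that contain an endpoint.\<close>

lemma inner_mass_Suc_ge:
  assumes IH: "\<And>s t. 0 \<le> s \<Longrightarrow> s \<le> t \<Longrightarrow> t \<le> 1 \<Longrightarrow> t - s - E \<le> inner_mass l s t"
    and E: "0 \<le> E" and st: "s \<le> t" "t \<le> 1"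
  defines "X \<equiv> {k\<in>{1..n}. s \<in> {1 / (real k + 1)<..<1 / real k} \<or> t \<in> {1 / (real k + 1)<..<1 / real k}}"
  shows "t - min t (max s (1 / (real n + 1))) - sum len X * E \<le> inner_mass (Suc l) s t"
proof -
  define f where "f k = min t (max s (1 / real k))" for k
  define e where "e k = (if s \<in> {1 / (real k + 1)<..<1 / real k} \<or> t \<in> {1 / (real k + 1)<..<1 / real k}
       then len k * E else 0)" for k
  have "f k - f (Suc k) - e k \<le> wt k * inner_mass l (branch k t) (branch k s)" if "k \<in> {1..n}" for k
    using wt_inner_mass_ge[OF IH E st(1), of k] that by (simp add: f_def e_def add.commute)
  then have "(\<Sum>k = 1..n. f k - f (Suc k) - e k) \<le> inner_mass (Suc l) s t"
    unfolding inner_mass.simps by (intro sum_mono)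
  moreover have "(\<Sum>k = 1..n. f k - f (Suc k) - e k) = f 1 - f (Suc n) - sum e {1..n}"
    by (simp only: sum_subtractf[of "\<lambda>k. f k - f (Suc k)"] sum_diff_Suc)
  moreover have "sum e {1..n} = sum len X * E"
    unfolding e_def X_def sum_distrib_right by (intro sum.inter_filter[symmetric]) simp
  moreover have "f 1 = t" "f (Suc n) = min t (max s (1 / (real n + 1)))"
    using st by (auto simp: f_def add.commute)
  ultimately show ?thesis by simp
qed

text \<open>One level turns an error \<open>E\<close> into at most \<open>2/3 * E + 1/(n+1)\<close>.
  This affine recursion has the fixed point \<open>3/(n+1)\<close> and starts with error at most
  1.\<close>

lemma inner_mass_coarse:
  assumes "0 \<le> s" "s \<le> t" "t \<le> 1"
  shows "t - s - (3 / (real n + 1) + (2 / 3) ^ l) \<le> inner_mass l s t"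
  using assms
proof (induction l arbitrary: s t)
  case 0
  have "0 \<le> 3 / (real n + 1)" by simp
  then have "t - s - (3 / (real n + 1) + 1) \<le> 0" using 0 by linarith
  then show ?case using inner_mass_nonneg[of 0 s t] by simp
next
  case (Suc l)
  define c p X where "c = 1 / (real n + 1)" "p = (2 / 3 :: real) ^ l"
    "X = {k\<in>{1..n}. s \<in> {1 / (real k + 1)<..<1 / real k} \<or> t \<in> {1 / (real k + 1)<..<1 / real k}}"
  note defs = this
  have c: "3 / (real n + 1) = 3 * c" and p: "(2 / 3 :: real) ^ Suc l = 2 / 3 * p" by (simp_all add: defs)
  have E: "0 \<le> 3 * c + p" by (simp add: defs)
  obtain i j where "\<forall>k\<ge>1. s \<in> {1 / (real k + 1)<..<1 / real k} \<longrightarrow> k = i"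
    "\<forall>k\<ge>1. t \<in> {1 / (real k + 1)<..<1 / real k} \<longrightarrow> k = j"
    using open_interval_index_unique by meson
  then have "sum len X \<le> 2 / 3" unfolding defs by (intro sum_len_pair_le[of _ i j]) auto
  then have 1: "sum len X * (3 * c + p) \<le> 2 / 3 * (3 * c + p)" using E by (rule mult_right_mono)
  have 2: "t - min t (max s c) - sum len X * (3 * c + p) \<le> inner_mass (Suc l) s t"
    unfolding defs(1,3)
  proof (rule inner_mass_Suc_ge)
    show "t - s - (3 * (1 / (real n + 1)) + p) \<le> inner_mass l s t"
      if "0 \<le> s" "s \<le> t" "t \<le> 1" for s t
      using Suc.IH[OF that] unfolding c defs(1,2) .
  qed (use E Suc.prems in \<open>auto simp: defs(1)\<close>)
  have "0 \<le> c" by (simp add: defs)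
  then have 3: "min t (max s c) \<le> s + c"
    using Suc.prems by (auto simp: min_le_iff_disj)
  have 4: "2 / 3 * (3 * c + p) = 2 * c + 2 / 3 * p" by (simp add: algebra_simps)
  show ?case unfolding c p using 1 2 3 4 by linarith
qed

text \<open>An additive error is useless for radii as small as \<open>len k\<close>, so it is made
  proportional to \<open>r\<close>. Since \<open>x\<close> lies above the gap, nothing is lost
  there, and the cells containing an endpoint have total length at most
  \<open>r + 3 * r\<close>.\<close>

lemma inner_mass_fine:
  assumes IH: "\<And>s t. 0 \<le> s \<Longrightarrow> s \<le> t \<Longrightarrow> t \<le> 1 \<Longrightarrow> t - s - E \<le> inner_mass l s t"
    and E: "0 \<le> E" and k: "k \<in> {1..n}" and x: "x \<in> {1 / (real k + 1)..1 / real k}"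
    and r: "len k \<le> r" "x + r \<le> 1"
  shows "r - 4 * r * E \<le> inner_mass (Suc l) x (x + r)"
proof -
  define X where "X = {k\<in>{1..n}. x \<in> {1 / (real k + 1)<..<1 / real k} \<or>
    x + r \<in> {1 / (real k + 1)<..<1 / real k}}"
  have r0: "0 < r" using r len_pos[of k] k by auto
  obtain j where j: "\<forall>k\<ge>1. x + r \<in> {1 / (real k + 1)<..<1 / real k} \<longrightarrow> k = j"
    using open_interval_index_unique by meson
  have xk: "k' = k" if "k' \<ge> 1" "x \<in> {1 / (real k' + 1)<..<1 / real k'}" for k'
  proof (rule ccontr)
    assume "k' \<noteq> k"
    then consider "k' < k" | "k < k'" by linarith
    then show False
    proof cases
      case 1
      then have "1 / real k \<le> 1 / (real k' + 1)" using that by (intro divide_left_mono) auto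
      then show False using that x by auto
    next
      case 2
      then have "1 / real k' \<le> 1 / (real k + 1)" using k by (intro divide_left_mono) auto
      then show False using that x by auto
    qed
  qed
  have X: "X \<subseteq> {k, j}" unfolding X_def using j xk by auto
  have "sum len X \<le> 4 * r"
  proof (cases "X \<subseteq> {k}")
    case True
    then have "sum len X \<le> sum len {k}" using len_pos[of k] k by (intro sum_mono2) auto
    then show ?thesis using r r0 by simp
  next
    case False
    then have jX: "j \<in> X" "j \<noteq> k" using X by auto
    then have j1: "j \<ge> 1" by (simp add: X_def)
    have t: "x + r \<in> {1 / (real j + 1)<..<1 / real j}" using jX xk[of j] by (auto simp: X_def)
    have "j < k"
    proof (rule ccontr)
      assume "\<not> j < k"
      then have "1 / real j \<le> 1 / (real k + 1)" using jX k by (intro divide_left_mono) auto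
      then show False using t x r0 by auto
    qed
    \<comment> \<open>Either cell \<open>Suc j\<close> is the cell of \<open>x\<close>, whose length
      is at most \<open>r\<close> by hypothesis, or it lies entirely between \<open>x\<close> and
      \<open>x + r\<close>.\<close>
    have "len (Suc j) \<le> r"
    proof (cases "Suc j = k")
      case False
      then have "1 / real k \<le> 1 / (real (Suc j) + 1)"
        using \<open>j < k\<close> by (intro divide_left_mono) auto
      then have "len (Suc j) \<le> 1 / (real j + 1) - 1 / real k"
        using len_eq_diff[of "Suc j"] by (simp add: add.commute)
      then show ?thesis using t x by auto
    qed (use r in auto)
    then have "len j \<le> 3 * r" using len_le_triple_Suc[OF j1] by linarith
    have "sum len X \<le> sum len {k, j}" using X len_pos[of k] len_pos[of j] k j1 by (intro sum_mono2) auto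
    then show ?thesis using \<open>len j \<le> 3 * r\<close> r jX by simp
  qed
  then have "sum len X * E \<le> 4 * r * E" using E by (rule mult_right_mono)
  moreover have "x + r - min (x + r) (max x (1 / (real n + 1))) - sum len X * E
      \<le> inner_mass (Suc l) x (x + r)"
    unfolding X_def using r r0 IH E by (intro inner_mass_Suc_ge) auto
  moreover have "1 / (real n + 1) \<le> 1 / (real k + 1)" using k by (intro divide_left_mono) auto
  then have "min (x + r) (max x (1 / (real n + 1))) = x" using x r0 by auto
  ultimately show ?thesis by linarith
qed

text \<open>For \<open>n\<close> at least 1 this is \<open>len n powr (h - 1)\<close>, the largest
  of the ratios \<open>wt k / len k\<close>. It bounds \<open>r powr h / r\<close> for all
  \<open>r\<close> from \<open>len n\<close> on.\<close>

definition distortion :: real where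
  "distortion = (real n * (real n + 1)) powr (1 - h)"

definition density_bound :: real where
  "density_bound = (1 - 16 / (real n + 1)) / distortion"

lemma powr_le_distortion:
  assumes "1 \<le> n" "len n \<le> r"
  shows "r powr h \<le> distortion * r"
proof -
  have r: "0 < r" using assms len_pos[of n] by simp
  have "len n powr (h - 1) = inverse (len n powr (1 - h))"
    using powr_minus[of "len n" "1 - h"] by simp
  also have "\<dots> = distortion"
    by (simp add: distortion_def len_def powr_divide)
  finally have len: "len n powr (h - 1) = distortion" .
  have "r powr h = r powr (h - 1) * r powr 1" using powr_add[of r "h - 1" 1] by simp
  also have "r powr 1 = r" using r by simp
  also have "r powr (h - 1) * r \<le> len n powr (h - 1) * r"
    using assms len_pos[of n] h_le_1 r by (intro mult_right_mono powr_mono2') auto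
  finally show ?thesis by (simp only: len)
qed

text \<open>If the right half of the ball stays in the unit interval, \<open>inner_mass_fine\<close>
  applies to it. Otherwise \<open>r\<close> is at least 1/2, so the coarse additive error is already
  proportional to \<open>r\<close>, and either the left half is used or the ball covers the whole
  unit interval.\<close>

lemma inner_mass_ball_large:
  assumes n: "n \<ge> 16" and k: "k \<in> {1..n}" and x: "x \<in> {1 / (real k + 1)..1 / real k}"
    and r: "len k \<le> r" "r \<le> 1"
  shows "\<exists>l. density_bound * r powr h \<le> inner_mass l (x - r) (x + r)"
proof -
  have r0: "0 < r" using r len_pos[of k] k by auto
  obtain l where l: "(2 / 3 :: real) ^ l < 1 / (real n + 1)"
    using real_arch_pow_inv[of "1 / (real n + 1)" "2 / 3"] by auto
  \<comment> \<open>The 4 is 3 from the fixed point of the coarse recursion plus 1 for the geometric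
    term. The loss \<open>4 * E\<close> is then the \<open>16/(n+1)\<close> of
    \<open>density_bound\<close>.\<close>
  define E where "E = 4 / (real n + 1)"
  have E0: "0 \<le> E" "4 * E \<le> 1" using n by (auto simp: E_def field_simps)
  have IH: "t - s - E \<le> inner_mass l s t" if "0 \<le> s" "s \<le> t" "t \<le> 1" for s t
    using inner_mass_coarse[OF that, of l] l add_divide_distrib[of 1 3 "real n + 1"]
    by (simp add: E_def)
  have "\<exists>l. r * (1 - 4 * E) \<le> inner_mass l (x - r) (x + r)"
  proof (cases "x + r \<le> 1")
    case True
    have "r - 4 * r * E \<le> inner_mass (Suc l) x (x + r)"
      using True k x r E0 IH by (intro inner_mass_fine) auto
    also have "\<dots> \<le> inner_mass (Suc l) (x - r) (x + r)" using r0 by (intro inner_mass_mono) auto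
    finally show ?thesis by (intro exI[of _ "Suc l"]) (simp add: algebra_simps)
  next
    case False
    have r2: "1 \<le> 2 * r"
    proof (cases "k = 1")
      case True
      then show ?thesis using r by (simp add: len_def)
    next
      case k2: False
      then have "1 / real k \<le> 1 / 2" using k by (intro divide_left_mono) auto
      then show ?thesis using False x by auto
    qed
    then have rE: "E \<le> 4 * r * E" using E0 mult_right_mono[of 1 "4 * r" E] by simp
    have "1 / real k \<le> 1" "0 \<le> 1 / (real k + 1)" using k by auto
    then have x01: "0 \<le> x" "x \<le> 1" using x unfolding atLeastAtMost_iff by linarith+
    show ?thesis
    proof (cases "0 \<le> x - r")
      case True
      have "x - (x - r) - E \<le> inner_mass l (x - r) x" using True x01 r0 by (intro IH) auto
      also have "\<dots> \<le> inner_mass l (x - r) (x + r)" using r0 by (intro inner_mass_mono) auto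
      finally show ?thesis using rE by (intro exI[of _ l]) (simp add: algebra_simps)
    next
      case *: False
      have "inner_mass l (x - r) (x + r) = 1" using False * by (intro inner_mass_full) auto
      then show ?thesis using r r0 E0 by (intro exI[of _ l]) (simp add: mult_le_one)
    qed
  qed
  moreover have "density_bound * r powr h \<le> r * (1 - 4 * E)"
  proof -
    have "len n \<le> r" using r len_antimono[of k n] k by auto
    then have "r powr h \<le> distortion * r" using n by (intro powr_le_distortion) auto
    then have "density_bound * r powr h \<le> density_bound * (distortion * r)"
      using E0 by (intro mult_left_mono) (auto simp: density_bound_def E_def distortion_def)
    also have "\<dots> = r * (1 - 4 * E)"
      using n by (simp add: density_bound_def E_def distortion_def)
    finally show ?thesis .
  qed
  ultimately show ?thesis by (meson order_trans)
qed

lemma inner_mass_ball: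
  assumes n: "n \<ge> 16" and x: "x \<in> limit_set n" and r: "0 < r" "r \<le> 1"
  shows "\<exists>l. density_bound * r powr h \<le> inner_mass l (x - r) (x + r)"
proof -
  \<comment> \<open>Each application of a branch at least doubles the radius, so \<open>m\<close>
    bounds the number of renormalisations. For \<open>m = 0\<close> the assumption contradicts
    \<open>r \<le> 1\<close>.\<close>
  obtain m where m: "(1 / 2 :: real) ^ m < r" using real_arch_pow_inv[of r "1 / 2"] r by auto
  show ?thesis using m x r
  proof (induction m arbitrary: x r)
    case 0
    then show ?case by simp
  next
    case (Suc m)
    obtain k y where k: "k \<in> {1..n}" and y: "y \<in> limit_set n" "y \<in> {0..1}" "x = contr k y"
      using limit_set_step[OF Suc.prems(2)] by blast
    have k1: "k \<ge> 1" using k by simp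
    show ?case
    proof (cases "len k \<le> r")
      case True
      then show ?thesis using n k contr_unit[OF k1 y(2)] y Suc.prems by (intro inner_mass_ball_large) auto
    next
      case False
      define r' where "r' = r / len k"
      have pos: "0 < len k" using len_pos[OF k1] .
      have "r * 2 \<le> r'"
        using len_le_half[OF k1] pos Suc.prems by (simp add: r'_def pos_le_divide_eq mult_left_le)
      then have "(1 / 2) ^ m < r'" using Suc.prems by simp
      moreover have "0 < r'" "r' \<le> 1" using False pos Suc.prems by (auto simp: r'_def)
      ultimately obtain l where l: "density_bound * r' powr h \<le> inner_mass l (y - r') (y + r')"
        using Suc.IH[of r' y] y by blast
      have br: "branch k (x + r) = y - r'" "branch k (x - r) = y + r'"
        using pos by (simp_all add: branch_eq[OF k1] y(3) contr_def r'_def field_simps)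
      have "density_bound * r powr h = wt k * (density_bound * r' powr h)"
        using pos Suc.prems by (simp add: r'_def powr_divide)
      also have "\<dots> \<le> wt k * inner_mass l (y - r') (y + r')" using l by (intro mult_left_mono) auto
      also have "\<dots> \<le> inner_mass (Suc l) (x - r) (x + r)"
        using member_le_sum[of k "{1..n}" "\<lambda>k. wt k * inner_mass l (branch k (x + r)) (branch k (x - r))"] k
        by (simp add: br inner_mass_nonneg)
      finally show ?thesis by blast
    qed
  qed
qed

lemma packing_sup_limit_set_le:
  assumes n: "n \<ge> 16"
  shows "packing_sup h 1 (limit_set n) \<le> ennreal (2 / density_bound)"
proof (rule packing_sup_leI)
  fix \<B> assume "\<B> \<in> packings 1 (limit_set n)" and fin: "finite \<B>"
  then have disj: "disjoint \<B>"
    and ball: "\<forall>B\<in>\<B>. \<exists>x\<in>limit_set n. \<exists>r. 0 < r \<and> r \<le> 1 \<and> B = cball x r"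
    by (auto simp: packings_def)
  from ball obtain c \<rho> where c: "\<And>B. B \<in> \<B> \<Longrightarrow> c B \<in> limit_set n \<and> 0 < \<rho> B \<and> \<rho> B \<le> 1 \<and> B = cball (c B) (\<rho> B)"
    by metis
  then have "\<exists>l. \<forall>B\<in>\<B>. density_bound * \<rho> B powr h \<le> inner_mass (l B) (c B - \<rho> B) (c B + \<rho> B)"
    using inner_mass_ball[OF n] by (intro bchoice) auto
  then obtain l where l: "\<And>B. B \<in> \<B> \<Longrightarrow> density_bound * \<rho> B powr h \<le> inner_mass (l B) (c B - \<rho> B) (c B + \<rho> B)"
    by blast
  have "16 / (real n + 1) < 1" "0 < distortion" using n by (auto simp: distortion_def)
  then have d: "0 < density_bound" by (simp add: density_bound_def)
  \<comment> \<open>The density estimate yields a level for each ball. Raising all of them to a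
    common level only increases the masses and makes them summable over disjoint balls.\<close>
  define m where "m = Max (l ` \<B>)"
  have "density_bound * (diameter B powr h) \<le> 2 * inner_mass m (c B - \<rho> B) (c B + \<rho> B)" if "B \<in> \<B>" for B
  proof -
    have B: "0 < \<rho> B" "B = cball (c B) (\<rho> B)" using c[of B] that by auto
    then have "diameter B = 2 * \<rho> B" using diameter_cball[of "c B" "\<rho> B"] by simp
    then have "diameter B powr h = 2 powr h * \<rho> B powr h" using B by (simp add: powr_mult)
    also have "\<dots> \<le> 2 powr 1 * \<rho> B powr h" using h_le_1 by (intro mult_right_mono powr_mono) auto
    finally have "density_bound * (diameter B powr h) \<le> 2 * (density_bound * \<rho> B powr h)"
      using d by simp
    also have "density_bound * \<rho> B powr h \<le> inner_mass (l B) (c B - \<rho> B) (c B + \<rho> B)"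
      using l that by auto
    also have "\<dots> \<le> inner_mass m (c B - \<rho> B) (c B + \<rho> B)"
      using fin that by (intro inner_mass_mono_level) (simp add: m_def)
    finally show ?thesis by simp
  qed
  then have "(\<Sum>B\<in>\<B>. density_bound * (diameter B powr h)) \<le> (\<Sum>B\<in>\<B>. 2 * inner_mass m (c B - \<rho> B) (c B + \<rho> B))"
    by (rule sum_mono)
  also have "\<dots> = 2 * (\<Sum>B\<in>\<B>. inner_mass m (c B - \<rho> B) (c B + \<rho> B))" by (simp add: sum_distrib_left)
  also have "\<dots> \<le> 2 * 1"
  proof (intro mult_left_mono inner_mass_disjoint_sum_le_1 fin)
    have "{c B - \<rho> B..c B + \<rho> B} = B" if "B \<in> \<B>" for B
      using c[of B] that by (metis cball_eq_atLeastAtMost)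
    then show "disjoint_family_on (\<lambda>B. {c B - \<rho> B..c B + \<rho> B}) \<B>"
      using disj by (simp add: disjoint_family_on_def disjoint_def)
  qed auto
  finally have "(\<Sum>B\<in>\<B>. diameter B powr h) \<le> 2 / density_bound"
    using d by (simp add: field_simps flip: sum_distrib_left)
  then show "(\<Sum>B\<in>\<B>. ennreal (diameter B powr h)) \<le> ennreal (2 / density_bound)"
    by (simp add: ennreal_leI)
qed

section \<open>Packings by balls next to the gap\<close>

text \<open>The total weight of the level-\<open>l\<close> closed cylinders that meet \<open>A\<close>.\<close>
primrec hit_mass :: "nat \<Rightarrow> real set \<Rightarrow> real" where
  "hit_mass 0 A = (if A \<inter> {0..1} = {} then 0 else 1)"
| "hit_mass (Suc l) A = (\<Sum>k = 1..n. wt k * hit_mass l (contr k -` A))"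

lemma hit_mass_nonneg: "0 \<le> hit_mass l A"
  by (induction l arbitrary: A) (auto intro!: sum_nonneg)

lemma hit_mass_Suc_le: "hit_mass (Suc l) A \<le> hit_mass l A"
proof (induction l arbitrary: A)
  case 0
  show ?case
  proof (cases "A \<inter> {0..1} = {}")
    case True
    then have "contr k -` A \<inter> {0..1} = {}" if "k \<in> {1..n}" for k
      using contr_in_unit[of k] that by auto
    then show ?thesis by simp
  next
    case False
    have "hit_mass (Suc 0) A \<le> (\<Sum>k = 1..n. wt k * 1)"
      unfolding hit_mass.simps by (intro sum_mono mult_left_mono) auto
    then show ?thesis using False moran by simp
  qed
next
  case (Suc l)
  show ?case
    unfolding hit_mass.simps(2)[of "Suc l"]
    by (subst hit_mass.simps(2)) (intro sum_mono mult_left_mono Suc.IH; simp)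
qed

lemma hit_mass_antimono: "l \<le> l' \<Longrightarrow> hit_mass l' A \<le> hit_mass l A"
  by (rule lift_Suc_antimono_le[of "\<lambda>l. hit_mass l A"]) (auto simp: hit_mass_Suc_le simp del: hit_mass.simps)

lemma hit_mass_le_1: "hit_mass l A \<le> 1"
  using hit_mass_antimono[of 0 l A] by (auto split: if_splits)

definition tail_wt :: real where
  "tail_wt = (\<Sum>k = n div 2..n. wt k)"

text \<open>
  The numerator is the value \<open>(2 r) powr h\<close> of the ball of radius \<open>r = 1/(n+2)\<close> used below; the
  branches \<open>n div 2, \<dots>, n\<close> contain this ball.
\<close>
definition packing_const :: real where
  "packing_const = (2 / (real n + 2)) powr h / tail_wt"

lemma tail_wt_bounds:
  assumes "n \<ge> 2"
  shows "wt n \<le> tail_wt" "0 < wt n" "tail_wt \<le> 1"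
proof -
  show "wt n \<le> tail_wt"
    unfolding tail_wt_def using assms by (intro member_le_sum) auto
  show "0 < wt n" using len_pos[of n] assms by simp
  have "tail_wt \<le> (\<Sum>k = 1..n. wt k)"
    unfolding tail_wt_def using assms by (intro sum_mono2) auto
  then show "tail_wt \<le> 1" using moran by simp
qed

lemma packing_const_nonneg: "0 \<le> packing_const"
  by (auto simp: packing_const_def tail_wt_def intro!: divide_nonneg_nonneg sum_nonneg)

text \<open>
  At each of \<open>t\<close> levels either \<open>A\<close> meets the last cylinder, so a ball is chosen and the weight
  \<open>tail_wt\<close> is used up, or \<open>A\<close> misses it, which costs the proportion \<open>wt n\<close> of \<open>hit_mass\<close>. The second
  error term charges the latter, the first one is the weight left over after \<open>t\<close> levels.
\<close>
lemma ex_fin_packing_ge: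
  assumes n: "n \<ge> 2" and "t \<le> N"
  shows "\<exists>\<B>. fin_packing 1 A \<B> \<and>
    packing_const * (hit_mass N A - (1 - tail_wt) ^ t * hit_mass 0 A
        - tail_wt / wt n * (hit_mass 0 A - hit_mass N A))
      \<le> (\<Sum>B\<in>\<B>. diameter B powr h)"
  using assms(2)
proof (induction t arbitrary: A N)
  case 0
  have "hit_mass N A \<le> hit_mass 0 A" using hit_mass_antimono[of 0 N] by blast
  moreover from this have "0 \<le> tail_wt / wt n * (hit_mass 0 A - hit_mass N A)"
    using tail_wt_bounds[OF n] by (intro mult_nonneg_nonneg divide_nonneg_nonneg) linarith+
  ultimately have "hit_mass N A - (1 - tail_wt) ^ 0 * hit_mass 0 A
        - tail_wt / wt n * (hit_mass 0 A - hit_mass N A) \<le> 0"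
    by (simp del: hit_mass.simps)
  then have "packing_const * (hit_mass N A - (1 - tail_wt) ^ 0 * hit_mass 0 A
        - tail_wt / wt n * (hit_mass 0 A - hit_mass N A)) \<le> 0"
    using packing_const_nonneg by (rule mult_nonneg_nonpos[rotated])
  then show ?case by (intro exI[of _ "{}"]) (simp add: fin_packing_def)
next
  case (Suc t)
  define \<alpha> where "\<alpha> = tail_wt"
  define D where "D = \<alpha> / wt n"
  define p where "p = (1 - \<alpha>) ^ t"
  have \<alpha>: "wt n \<le> \<alpha>" "0 < wt n" "\<alpha> \<le> 1" unfolding \<alpha>_def by (fact tail_wt_bounds[OF n])+
  have "0 \<le> D" unfolding D_def using \<alpha> by (intro divide_nonneg_nonneg) linarith+
  \<comment> \<open>The identity \<open>D * wt n = \<alpha>\<close> says that losing the proportion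
    \<open>wt n\<close> of mass earns a credit of \<open>\<alpha>\<close>.\<close>
  moreover have "D * wt n = \<alpha>" using \<alpha> by (auto simp: D_def)
  ultimately have D: "0 \<le> D" "D * wt n = \<alpha>" .
  have "0 \<le> 1 - \<alpha>" "1 - \<alpha> \<le> 1" using \<alpha> by linarith+
  then have p: "0 \<le> p" "p \<le> 1" by (simp_all add: p_def power_le_one)
  obtain M where N: "N = Suc M" "t \<le> M" using Suc.prems by (cases N) auto
  define a b where "a k = hit_mass M (contr k -` A)" "b k = hit_mass 0 (contr k -` A)" for k
  have ab: "0 \<le> a k" "a k \<le> b k" "b k \<le> 1" "a k \<le> 1" for k
    unfolding a_b_def by (rule hit_mass_nonneg hit_mass_antimono hit_mass_le_1; simp)+
  have "\<exists>\<B>. fin_packing 1 (contr k -` A) \<B> \<and>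
    packing_const * (a k - p * b k - D * (b k - a k)) \<le> (\<Sum>B\<in>\<B>. diameter B powr h)" for k
    using Suc.IH[OF N(2), of "contr k -` A"] unfolding a_b_def p_def D_def \<alpha>_def .
  then obtain P where P: "\<And>k. fin_packing 1 (contr k -` A) (P k)"
    "\<And>k. packing_const * (a k - p * b k - D * (b k - a k)) \<le> (\<Sum>B\<in>P k. diameter B powr h)" by metis
  have N': "hit_mass N A = (\<Sum>k = 1..n. wt k * a k)" by (simp add: N a_b_def)
  have H1: "hit_mass (Suc 0) A = (\<Sum>k = 1..n. wt k * b k)" by (simp add: a_b_def)
  have H10: "(\<Sum>k = 1..n. wt k * b k) \<le> hit_mass 0 A" using hit_mass_Suc_le[of 0 A] H1 by simp
  have val: "packing_const * ((\<Sum>k\<in>S. wt k * a k) - p * (\<Sum>k\<in>S. wt k * b k)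
        - D * (\<Sum>k\<in>S. wt k * (b k - a k)))
      \<le> (\<Sum>B\<in>(\<Union>k\<in>S. (`) (contr k) ` P k). diameter B powr h)" if S: "S \<subseteq> {1..n}" for S
  proof -
    have "packing_const * ((\<Sum>k\<in>S. wt k * a k) - p * (\<Sum>k\<in>S. wt k * b k) - D * (\<Sum>k\<in>S. wt k * (b k - a k)))
      = (\<Sum>k\<in>S. wt k * (packing_const * (a k - p * b k - D * (b k - a k))))"
      by (simp add: sum_distrib_left sum_subtractf sum.distrib algebra_simps)
    also have "\<dots> \<le> (\<Sum>k\<in>S. wt k * (\<Sum>B\<in>P k. diameter B powr h))"
      using P by (intro sum_mono mult_left_mono) auto
    also have "\<dots> = (\<Sum>B\<in>(\<Union>k\<in>S. (`) (contr k) ` P k). diameter B powr h)"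
      using fin_packing_UN_contr(3)[OF S P(1)] by simp
    finally show ?thesis .
  qed
  have sub: "(\<Sum>k = 1..n. wt k * (b k - a k)) = (\<Sum>k = 1..n. wt k * b k) - hit_mass N A"
    by (simp add: N' right_diff_distrib sum_subtractf)
  show ?case
  proof (cases "A \<inter> {1 / (real n + 1)..1 / real n} = {}")
    case True
    let ?\<C> = "\<Union>k\<in>{1..n}. (`) (contr k) ` P k"
    \<comment> \<open>The preimage of \<open>A\<close> under the last branch misses the unit
      interval, so one level of refinement loses at least the weight \<open>wt n\<close>.\<close>
    have "(\<Sum>k = 1..n. wt k * b k) \<le> (1 - wt n) * hit_mass 0 A"
    proof (cases "hit_mass 0 A = 1")
      case True
      have "b n = 0"
        using \<open>A \<inter> {1 / (real n + 1)..1 / real n} = {}\<close> contr_unit[of n] n by (auto simp: a_b_def)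
      have "(\<Sum>k = 1..n. wt k * b k) \<le> (\<Sum>k = 1..n. wt k * (if k = n then 0 else 1))"
        using ab \<open>b n = 0\<close> by (intro sum_mono mult_left_mono) auto
      also have "\<dots> = (\<Sum>k = 1..n. wt k - (if k = n then wt k else 0))" by (intro sum.cong) auto
      also have "\<dots> = 1 - wt n" using moran n by (simp add: sum_subtractf)
      finally show ?thesis using True by simp
    next
      case False
      then have "hit_mass 0 A = 0" by (auto split: if_splits)
      then show ?thesis using H10 by simp
    qed
    then have "(p + D) * (\<Sum>k = 1..n. wt k * b k) \<le> (p + D) * ((1 - wt n) * hit_mass 0 A)"
      using p D by (intro mult_left_mono) auto
    also have "\<dots> = (p + D - p * wt n - \<alpha>) * hit_mass 0 A" using D(2) by (simp add: algebra_simps del: hit_mass.simps)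
    \<comment> \<open>Because \<open>p \<le> 1\<close>, the credit \<open>\<alpha>\<close> pays for
      the decrease \<open>p * \<alpha>\<close> from \<open>p\<close> to the next power of
      \<open>1 - \<alpha>\<close>.\<close>
    also have "\<dots> \<le> (p + D - p * \<alpha>) * hit_mass 0 A"
    proof (intro mult_right_mono hit_mass_nonneg)
      have "0 \<le> \<alpha>" using \<alpha> by linarith
      then have "p * \<alpha> \<le> \<alpha>" using p by (intro mult_left_le_one_le)
      moreover have "0 \<le> p * wt n" using p by simp
      ultimately show "p + D - p * wt n - \<alpha> \<le> p + D - p * \<alpha>" by simp
    qed
    finally have "hit_mass N A - (1 - \<alpha>) ^ Suc t * hit_mass 0 A - D * (hit_mass 0 A - hit_mass N A)
      \<le> (\<Sum>k = 1..n. wt k * a k) - p * (\<Sum>k = 1..n. wt k * b k) - D * (\<Sum>k = 1..n. wt k * (b k - a k))"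
      unfolding sub N'[symmetric] by (simp add: algebra_simps p_def del: hit_mass.simps)
    then have "packing_const * (hit_mass N A - (1 - \<alpha>) ^ Suc t * hit_mass 0 A - D * (hit_mass 0 A - hit_mass N A))
      \<le> packing_const * ((\<Sum>k = 1..n. wt k * a k) - p * (\<Sum>k = 1..n. wt k * b k) - D * (\<Sum>k = 1..n. wt k * (b k - a k)))"
      using packing_const_nonneg by (rule mult_left_mono)
    also have "\<dots> \<le> (\<Sum>B\<in>?\<C>. diameter B powr h)" by (rule val) simp
    finally have "packing_const * (hit_mass N A - (1 - \<alpha>) ^ Suc t * hit_mass 0 A - D * (hit_mass 0 A - hit_mass N A))
      \<le> (\<Sum>B\<in>?\<C>. diameter B powr h)" .
    moreover have "fin_packing 1 A ?\<C>"
      by (rule fin_packing_mono[OF fin_packing_UN_contr(1)[of "{1..n}" n, OF order_refl P(1)]]) simp_all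
    ultimately show ?thesis unfolding \<alpha>_def D_def by blast
  next
    case False
    then obtain y where y: "y \<in> A" "1 / (real n + 1) \<le> y" "y \<le> 1 / real n" by auto
    define j where "j = n div 2"
    have j: "1 \<le> j" "j \<le> n" "2 * real j \<le> real n" using n unfolding j_def by linarith+
    \<comment> \<open>The radius stays below \<open>1/(n+1) \<le> y\<close>, so the ball avoids 0.
      Its right end is below \<open>2/n \<le> 1/j\<close>, so it is disjoint from the cells of the
      branches before \<open>j\<close>, which are the only ones kept.\<close>
    define r where "r = 1 / (real n + 2)"
    have r: "0 < r" "r < 1 / (real n + 1)" "r < 1 / real n" "r \<le> 1" using n by (auto simp: r_def field_simps)
    have "2 / real n \<le> 1 / real j" using j n by (simp add: field_simps)
    then have yr: "0 < y - r" "y + r < 1 / real j" using y r by auto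
    have h0: "hit_mass 0 A = 1"
    proof -
      have "1 / real n \<le> 1" "0 \<le> 1 / (real n + 1)" using n by auto
      then have "0 \<le> y" "y \<le> 1" using y by linarith+
      then show ?thesis using y by auto
    qed
    define \<C> where "\<C> = (\<Union>k\<in>{1..<j}. (`) (contr k) ` P k)"
    let ?B = "cball y r"
    have S: "{1..<j} \<subseteq> {1..n}" using j by auto
    note C = fin_packing_UN_contr[OF S P(1), folded \<C>_def]
    have disj: "?B \<inter> C = {}" if C': "C \<in> \<C>" for C
    proof -
      obtain k where k: "k \<in> {1..<j}" "C \<subseteq> cell k" using bspec[OF C(2) C'] by blast
      then have "1 / real j \<le> 1 / (real k + 1)" by (intro divide_left_mono) auto
      then have "?B \<inter> cell k = {}" using yr by (auto simp: cell_def cball_eq_atLeastAtMost)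
      then show ?thesis using k by blast
    qed
    have "y \<in> ?B" using r by simp
    then have nin: "?B \<notin> \<C>" using disj by blast
    have "1 / real j \<le> 1" using j by simp
    then have B01: "?B \<subseteq> {0<..<1}" using yr by (auto simp: cball_eq_atLeastAtMost)
    have C1: "fin_packing 1 A \<C>" by (rule fin_packing_mono[OF C(1)]) simp
    have pack: "fin_packing 1 A (insert ?B \<C>)"
      unfolding fin_packing_def
    proof (intro conjI ballI)
      show "finite (insert ?B \<C>)" using C1 by (simp add: fin_packing_def)
      have "disjoint \<C>" using C1 by (simp add: fin_packing_def)
      then show "disjoint (insert ?B \<C>)" using disj unfolding disjoint_def by blast
      fix C assume C: "C \<in> insert ?B \<C>"
      show "C \<subseteq> {0<..<1}" using C C1 B01 unfolding fin_packing_def by blast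
      show "\<exists>x\<in>A. \<exists>r. 0 < r \<and> r \<le> 1 \<and> C = cball x r"
        using C C1 y(1) r unfolding fin_packing_def by blast
    qed
    have split: "(\<Sum>k = 1..n. f k) = (\<Sum>k\<in>{1..<j}. f k) + (\<Sum>k = j..n. f k)" for f :: "nat \<Rightarrow> real"
    proof -
      have "{1..n} = {1..<j} \<union> {j..n}" using j by auto
      then show ?thesis by (simp add: sum.union_disjoint ivl_disj_int)
    qed
    have \<alpha>_eq: "\<alpha> = (\<Sum>k = j..n. wt k)" by (simp add: \<alpha>_def tail_wt_def j_def)
    have "hit_mass N A \<le> \<alpha> + (\<Sum>k\<in>{1..<j}. wt k * a k)"
    proof -
      have "(\<Sum>k = j..n. wt k * a k) \<le> (\<Sum>k = j..n. wt k)"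
        using ab by (intro sum_mono) (simp add: mult_left_le)
      then show ?thesis unfolding N' \<alpha>_eq split by simp
    qed
    moreover have "p * (\<Sum>k\<in>{1..<j}. wt k * b k) \<le> p * (1 - \<alpha>)"
    proof (intro mult_left_mono p)
      have "(\<Sum>k\<in>{1..<j}. wt k * b k) \<le> (\<Sum>k\<in>{1..<j}. wt k)"
        using ab by (intro sum_mono) (simp add: mult_left_le)
      then show "(\<Sum>k\<in>{1..<j}. wt k * b k) \<le> 1 - \<alpha>" using moran split[of wt] \<alpha>_eq by simp
    qed
    moreover have "D * (\<Sum>k\<in>{1..<j}. wt k * (b k - a k)) \<le> D * (hit_mass 0 A - hit_mass N A)"
    proof (intro mult_left_mono D)
      have "(\<Sum>k\<in>{1..<j}. wt k * (b k - a k)) \<le> (\<Sum>k = 1..n. wt k * (b k - a k))"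
        using ab S by (intro sum_mono2) auto
      then show "(\<Sum>k\<in>{1..<j}. wt k * (b k - a k)) \<le> hit_mass 0 A - hit_mass N A"
        using H10 sub by linarith
    qed
    ultimately have "hit_mass N A - (1 - \<alpha>) ^ Suc t * hit_mass 0 A - D * (hit_mass 0 A - hit_mass N A)
      \<le> \<alpha> + ((\<Sum>k\<in>{1..<j}. wt k * a k) - p * (\<Sum>k\<in>{1..<j}. wt k * b k)
           - D * (\<Sum>k\<in>{1..<j}. wt k * (b k - a k)))" (is "?l \<le> \<alpha> + ?r")
      unfolding h0 by (simp add: p_def mult.commute)
    then have "packing_const * ?l \<le> packing_const * (\<alpha> + ?r)"
      using packing_const_nonneg by (rule mult_left_mono)
    also have "\<dots> = packing_const * \<alpha> + packing_const * ?r" by (rule distrib_left)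
    \<comment> \<open>The discarded branches weigh \<open>\<alpha>\<close> in total, and
      \<open>packing_const\<close> is chosen so that the new ball pays exactly for them.\<close>
    also have "packing_const * \<alpha> = diameter ?B powr h"
    proof -
      have diam: "diameter ?B = 2 / (real n + 2)" using r diameter_cball[of y r] by (simp add: r_def)
      have "\<alpha> \<noteq> 0" using \<alpha> by linarith
      then show ?thesis unfolding diam by (simp add: packing_const_def flip: \<alpha>_def)
    qed
    also have "diameter ?B powr h + packing_const * ?r \<le> (\<Sum>B\<in>insert ?B \<C>. diameter B powr h)"
      using val[OF S, folded \<C>_def] nin C(1) by (simp add: fin_packing_def)
    finally have "packing_const * ?l \<le> (\<Sum>B\<in>insert ?B \<C>. diameter B powr h)" .
    then show ?thesis using pack unfolding \<alpha>_def D_def by blast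
  qed
qed

text \<open>Transporting the packings through \<open>l\<close> levels of branches makes the radii at
  most \<open>(1 / 2) ^ l\<close>. The error terms are averaged by a probability vector at each
  level and hence do not grow.\<close>

lemma ex_fine_fin_packing_ge:
  assumes n: "n \<ge> 2" and tN: "t \<le> N"
  shows "\<exists>\<B>. fin_packing ((1 / 2) ^ l) A \<B> \<and>
    packing_const * (hit_mass (l + N) A - (1 - tail_wt) ^ t
        - tail_wt / wt n * (hit_mass l A - hit_mass (l + N) A))
      \<le> (\<Sum>B\<in>\<B>. diameter B powr h)"
proof (induction l arbitrary: A)
  case 0
  obtain \<B> where \<B>: "fin_packing 1 A \<B>"
    "packing_const * (hit_mass N A - (1 - tail_wt) ^ t * hit_mass 0 A
        - tail_wt / wt n * (hit_mass 0 A - hit_mass N A))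
      \<le> (\<Sum>B\<in>\<B>. diameter B powr h)" using ex_fin_packing_ge[OF n tN] by blast
  have "(1 - tail_wt) ^ t * hit_mass 0 A \<le> (1 - tail_wt) ^ t"
    using hit_mass_le_1 tail_wt_bounds[OF n] by (intro mult_left_le) auto
  then have "packing_const * (hit_mass N A - (1 - tail_wt) ^ t
        - tail_wt / wt n * (hit_mass 0 A - hit_mass N A)) \<le>
      packing_const * (hit_mass N A - (1 - tail_wt) ^ t * hit_mass 0 A
        - tail_wt / wt n * (hit_mass 0 A - hit_mass N A))"
    using packing_const_nonneg by (intro mult_left_mono) linarith+
  then show ?case using \<B> by (intro exI[of _ \<B>]) (simp del: hit_mass.simps)
next
  case (Suc l)
  define p D where "p = (1 - tail_wt) ^ t" "D = tail_wt / wt n"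
  define a b where "a k = hit_mass (l + N) (contr k -` A)" "b k = hit_mass l (contr k -` A)" for k
  have "\<exists>\<B>. fin_packing ((1 / 2) ^ l) (contr k -` A) \<B> \<and>
      packing_const * (a k - p - D * (b k - a k)) \<le> (\<Sum>B\<in>\<B>. diameter B powr h)" for k
    using Suc.IH[of "contr k -` A"] unfolding p_D_def a_b_def .
  then obtain P where P: "\<And>k. fin_packing ((1 / 2) ^ l) (contr k -` A) (P k)"
    "\<And>k. packing_const * (a k - p - D * (b k - a k)) \<le> (\<Sum>B\<in>P k. diameter B powr h)" by metis
  let ?\<C> = "\<Union>k\<in>{1..n}. (`) (contr k) ` P k"
  note C = fin_packing_UN_contr[of "{1..n}" n, OF order_refl P(1)]
  have "hit_mass (Suc l + N) A = (\<Sum>k = 1..n. wt k * a k)" "hit_mass (Suc l) A = (\<Sum>k = 1..n. wt k * b k)"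
    by (simp_all add: a_b_def)
  then have "packing_const * (hit_mass (Suc l + N) A - p - D * (hit_mass (Suc l) A - hit_mass (Suc l + N) A))
      = packing_const * ((\<Sum>k = 1..n. wt k * a k) - p * (\<Sum>k = 1..n. wt k)
          - D * ((\<Sum>k = 1..n. wt k * b k) - (\<Sum>k = 1..n. wt k * a k)))"
    by (simp only: moran mult_1_right)
  also have "\<dots> = (\<Sum>k = 1..n. wt k * (packing_const * (a k - p - D * (b k - a k))))"
    by (simp add: sum_distrib_left sum_subtractf sum.distrib algebra_simps)
  also have "\<dots> \<le> (\<Sum>k = 1..n. wt k * (\<Sum>B\<in>P k. diameter B powr h))"
    using P by (intro sum_mono mult_left_mono) auto
  also have "\<dots> = (\<Sum>B\<in>?\<C>. diameter B powr h)"
    using C(3) by simp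
  finally show ?case using C(1) unfolding p_D_def by (intro exI[of _ ?\<C>]) (simp add: mult.commute)
qed

text \<open>First \<open>l\<close> is taken so large that \<open>hit_mass\<close> is within
  \<open>e\<close> of its infimum and the radii are below \<open>\<delta>\<close>. Then
  \<open>t\<close> makes the leftover power smaller than \<open>e\<close>. For fixed
  \<open>n\<close> the factor \<open>D\<close> is fixed, so the total error \<open>e + D * e\<close>
  vanishes with \<open>e\<close>.\<close>

lemma packing_premeasure_ge:
  assumes n: "n \<ge> 2"
  shows "ennreal (packing_const * (INF l. hit_mass l A)) \<le> packing_premeasure h A"
  unfolding packing_premeasure_def
proof (rule INF_greatest)
  fix \<delta> :: real assume "\<delta> \<in> {0<..}"
  then have \<delta>: "0 < \<delta>" by simp
  define m where "m = (INF l. hit_mass l A)"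
  have bdd: "bdd_below (range (\<lambda>l. hit_mass l A))"
    by (intro bdd_belowI[of _ 0]) (auto simp: hit_mass_nonneg)
  have m_le: "m \<le> hit_mass l A" for l unfolding m_def by (intro cINF_lower bdd) simp
  define D where "D = tail_wt / wt n"
  note \<alpha> = tail_wt_bounds[OF n]
  have D: "0 \<le> D" unfolding D_def using \<alpha> by (intro divide_nonneg_nonneg) linarith+
  have approx: "ennreal (packing_const * (m - e - D * e)) \<le> packing_sup h \<delta> A" if e: "0 < e" for e
  proof -
    obtain l0 where l0: "hit_mass l0 A < m + e"
      using cINF_less_iff[OF _ bdd, of "m + e"] e unfolding m_def by auto
    obtain l1 where l1: "(1 / 2 :: real) ^ l1 < \<delta>" using real_arch_pow_inv[OF \<delta>, of "1/2"] by auto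
    define l where "l = max l0 l1"
    have "(1 / 2 :: real) ^ l \<le> (1 / 2) ^ l1" unfolding l_def by (intro power_decreasing) auto
    then have l\<delta>: "(1 / 2 :: real) ^ l \<le> \<delta>" using l1 by linarith
    have le: "hit_mass l A \<le> m + e" using l0 hit_mass_antimono[of l0 l A] by (simp add: l_def)
    obtain t where t: "(1 - tail_wt) ^ t < e"
      using real_arch_pow_inv[OF e, of "1 - tail_wt"] \<alpha> by auto
    obtain \<B> where \<B>: "fin_packing ((1 / 2) ^ l) A \<B>"
      "packing_const * (hit_mass (l + t) A - (1 - tail_wt) ^ t - D * (hit_mass l A - hit_mass (l + t) A))
        \<le> (\<Sum>B\<in>\<B>. diameter B powr h)"
      using ex_fine_fin_packing_ge[OF n order_refl, of l A t] unfolding D_def by blast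
    have "D * (hit_mass l A - hit_mass (l + t) A) \<le> D * e"
      using D le m_le[of "l + t"] by (intro mult_left_mono) auto
    then have "packing_const * (m - e - D * e)
        \<le> packing_const * (hit_mass (l + t) A - (1 - tail_wt) ^ t - D * (hit_mass l A - hit_mass (l + t) A))"
      using t m_le[of "l + t"] packing_const_nonneg by (intro mult_left_mono) linarith+
    then have "ennreal (packing_const * (m - e - D * e)) \<le> ennreal (\<Sum>B\<in>\<B>. diameter B powr h)"
      using \<B>(2) by (intro ennreal_leI) linarith
    also have "\<dots> = (\<Sum>B\<in>\<B>. ennreal (diameter B powr h))" by simp
    also have "\<dots> \<le> packing_sup h \<delta> A"
      using fin_packing_imp_packing[OF \<B>(1) l\<delta>] \<B>(1) by (intro sum_le_packing_sup) (simp_all add: fin_packing_def)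
    finally show ?thesis .
  qed
  have "((\<lambda>e. ennreal (packing_const * (m - e - D * e))) \<longlongrightarrow> ennreal (packing_const * (m - 0 - D * 0))) (at_right 0)"
    by (intro tendsto_intros)
  moreover have "\<forall>\<^sub>F e in at_right 0. ennreal (packing_const * (m - e - D * e)) \<le> packing_sup h \<delta> A"
    using approx by (auto simp: eventually_at_filter)
  ultimately have "ennreal (packing_const * (m - 0 - D * 0)) \<le> packing_sup h \<delta> A"
    by (rule tendsto_upperbound) simp
  then show "ennreal (packing_const * (INF l. hit_mass l A)) \<le> packing_sup h \<delta> A" by (simp add: m_def)
qed

text \<open>
  Some child of every word keeps the total below \<open>1\<close>. After \<open>l i\<close> steps the \<open>i\<close>-th term is \<open>0\<close> or \<open>1\<close>,
  hence \<open>0\<close>, so the nested cylinders leave every \<open>A i\<close>.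
\<close>
lemma ex_limit_point_avoiding:
  fixes A :: "nat \<Rightarrow> real set"
  assumes less: "(\<Sum>i. ennreal (hit_mass (l i) (A i))) < 1"
  shows "\<exists>x\<in>limit_set n. \<forall>i. x \<notin> A i"
proof -
  \<comment> \<open>This is the hit mass relative to the cylinder of the word \<open>q\<close>,
    summed over all sets. The truncated subtraction freezes the \<open>i\<close>-th term at level 0
    once the word is longer than \<open>l i\<close>.\<close>
  define W where "W q = (\<Sum>i. ennreal (hit_mass (l i - length q) (foldr contr q -` A i)))" for q
  have step: "\<exists>k\<in>{1..n}. W (q @ [k]) < 1" if q: "W q < 1" for q
  proof (rule ccontr)
    assume "\<not> ?thesis"
    then have ge: "1 \<le> W (q @ [k])" if "k \<in> {1..n}" for k using that by force
    have "1 = (\<Sum>k = 1..n. ennreal (wt k) * 1)" using moran by (simp add: sum_ennreal)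
    also have "\<dots> \<le> (\<Sum>k = 1..n. ennreal (wt k) * W (q @ [k]))"
      using ge by (intro sum_mono mult_left_mono) auto
    also have "\<dots> = (\<Sum>i. \<Sum>k = 1..n. ennreal (wt k) *
        ennreal (hit_mass (l i - length (q @ [k])) (foldr contr (q @ [k]) -` A i)))"
      unfolding W_def by (simp add: suminf_sum ennreal_suminf_cmult)
    also have "\<dots> \<le> W q"
      unfolding W_def
    proof (intro suminf_le)
      fix i
      define B where "B = foldr contr q -` A i"
      have B: "foldr contr (q @ [k]) -` A i = contr k -` B" for k by (auto simp: B_def)
      have "(\<Sum>k = 1..n. ennreal (wt k) * ennreal (hit_mass (l i - length (q @ [k])) (contr k -` B)))
        = ennreal (\<Sum>k = 1..n. wt k * hit_mass (l i - length (q @ [k])) (contr k -` B))"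
        by (simp add: sum_ennreal ennreal_mult hit_mass_nonneg flip: sum_ennreal)
      also have "(\<Sum>k = 1..n. wt k * hit_mass (l i - length (q @ [k])) (contr k -` B))
        = hit_mass (Suc (l i - Suc (length q))) B" by simp
      also have "\<dots> \<le> hit_mass (l i - length q) B"
      \<comment> \<open>Before level \<open>l i\<close> is reached the recursion gives equality.
        Afterwards both differences are 0, and refining by one level can only decrease the
        mass.\<close>
      proof (cases "l i - length q")
        case 0
        then have "l i - Suc (length q) = 0" by simp
        then show ?thesis using 0 hit_mass_Suc_le[of 0 B] by (simp del: hit_mass.simps)
      next
        case (Suc m)
        then have "l i - Suc (length q) = m" by simp
        then show ?thesis using Suc by (simp del: hit_mass.simps)
      qed
      finally show "(\<Sum>k = 1..n. ennreal (wt k) * ennreal (hit_mass (l i - length (q @ [k])) (foldr contr (q @ [k]) -` A i)))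
          \<le> ennreal (hit_mass (l i - length q) (foldr contr q -` A i))"
        unfolding B B_def[symmetric] by (simp add: ennreal_leI)
    qed auto
    finally show False using q by simp
  qed
  have "\<exists>q. \<forall>m. (length (q m) = m \<and> set (q m) \<subseteq> {1..n} \<and> W (q m) < 1) \<and> (\<exists>k. q (Suc m) = q m @ [k])"
  proof (rule dependent_nat_choice)
    show "\<exists>x. length x = 0 \<and> set x \<subseteq> {1..n} \<and> W x < 1"
      using less by (intro exI[of _ "[]"]) (simp add: W_def)
    fix q :: "nat list" and m
    assume q: "length q = m \<and> set q \<subseteq> {1..n} \<and> W q < 1"
    then obtain k where "k \<in> {1..n}" "W (q @ [k]) < 1" using step[of q] by blast
    with q show "\<exists>y. (length y = Suc m \<and> set y \<subseteq> {1..n} \<and> W y < 1) \<and> (\<exists>k. y = q @ [k])"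
      by (intro exI[of _ "q @ [k]"]) simp
  qed
  then obtain q where q: "\<And>m. length (q m) = m" "\<And>m. set (q m) \<subseteq> {1..n}" "\<And>m. W (q m) < 1"
    "\<And>m. \<exists>k. q (Suc m) = q m @ [k]" by blast
  define I where "I m = foldr contr (q m) ` {0..1}" for m
  have cont: "continuous_on {0..1} (foldr contr w)" for w
  proof (induction w)
    case Nil
    show ?case by (simp add: id_def)
  next
    case (Cons k w)
    have "foldr contr (k # w) = (\<lambda>y. 1 / real k - len k * foldr contr w y)"
      by (simp add: fun_eq_iff contr_def[of k "foldr contr w _"])
    then show ?case by (simp only:) (intro continuous_intros Cons.IH)
  qed
  have I: "compact (I m)" "I m \<noteq> {}" for m
    unfolding I_def by (auto intro!: compact_continuous_image cont)
  have "I (Suc m) \<subseteq> I m" for m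
  proof -
    obtain k where k: "q (Suc m) = q m @ [k]" using q(4) by blast
    then have "k \<ge> 1" using q(2)[of "Suc m"] by auto
    then show ?thesis unfolding I_def k using contr_in_unit[of k] by auto
  qed
  then have "I m' \<subseteq> I m" if "m \<le> m'" for m m' using that by (rule lift_Suc_antimono_le)
  then have "\<Inter> (range I) \<noteq> {}" using I by (intro compact_nest) auto
  then obtain x where x: "\<And>m. x \<in> I m" by blast
  have "x \<in> limit_set n"
    unfolding mem_limit_set using q(1,2) x unfolding I_def by blast
  moreover have "x \<notin> A i" for i
  proof
    assume "x \<in> A i"
    obtain y where y: "y \<in> {0..1}" "x = foldr contr (q (l i)) y" using x[of "l i"] unfolding I_def by blast
    have "ennreal (hit_mass (l i - length (q (l i))) (foldr contr (q (l i)) -` A i)) \<le> W (q (l i))"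
      unfolding W_def using sum_le_suminf[of "\<lambda>i'. ennreal (hit_mass (l i' - length (q (l i))) (foldr contr (q (l i)) -` A i'))" "{i}"]
      by simp
    also have "\<dots> < 1" by (rule q(3))
    finally have "foldr contr (q (l i)) -` A i \<inter> {0..1} = {}" by (simp add: q(1) split: if_splits)
    then show False using y \<open>x \<in> A i\<close> by auto
  qed
  ultimately show ?thesis by blast
qed

text \<open>This replaces countable subadditivity of the self-similar measure. If the infima summed
  to less than 1, finite levels with errors \<open>e / 2 ^ (i + 1)\<close> would do so as well, and
  some limit point would escape the cover.\<close>

lemma cover_hit_mass_ge_1:
  fixes A :: "nat \<Rightarrow> real set"
  assumes "limit_set n \<subseteq> (\<Union>i. A i)"
  shows "1 \<le> (\<Sum>i. ennreal (INF l. hit_mass l (A i)))"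
proof (rule ccontr)
  define m where "m i = (INF l. hit_mass l (A i))" for i
  assume "\<not> ?thesis"
  then have less: "(\<Sum>i. ennreal (m i)) < 1" by (simp add: m_def)
  have bdd: "bdd_below (range (\<lambda>l. hit_mass l (A i)))" for i
    by (intro bdd_belowI[of _ 0]) (auto simp: hit_mass_nonneg)
  have m0: "0 \<le> m i" for i unfolding m_def by (intro cINF_greatest) (auto simp: hit_mass_nonneg)
  obtain e where e: "0 < e" "(\<Sum>i. ennreal (m i)) + ennreal e < 1"
  proof -
    obtain s where s: "(\<Sum>i. ennreal (m i)) = ennreal s" "0 \<le> s"
      using less by (cases "\<Sum>i. ennreal (m i)") auto
    then have "s < 1" using less by (simp add: ennreal_less_one_iff)
    then have "0 < (1 - s) / 2" "s + (1 - s) / 2 < 1" by (simp_all add: field_simps)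
    then show ?thesis
      using s that[of "(1 - s) / 2"] by (simp add: ennreal_less_one_iff flip: ennreal_plus)
  qed
  have "\<exists>l. hit_mass l (A i) < m i + e * (1 / 2) ^ Suc i" for i
    using cINF_less_iff[OF _ bdd[of i], of "m i + e * (1 / 2) ^ Suc i"] e unfolding m_def by auto
  then obtain l where l: "\<And>i. hit_mass (l i) (A i) < m i + e * (1 / 2) ^ Suc i" by metis
  have "(\<Sum>i. ennreal (hit_mass (l i) (A i))) \<le> (\<Sum>i. ennreal (m i) + ennreal (e * (1 / 2) ^ Suc i))"
    using l m0 e by (intro suminf_le) (auto simp: less_imp_le simp del: power_Suc simp flip: ennreal_plus intro!: ennreal_leI)
  also have "\<dots> = (\<Sum>i. ennreal (m i)) + (\<Sum>i. ennreal (e * (1 / 2) ^ Suc i))"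
    by (intro suminf_add[symmetric]) auto
  also have "(\<Sum>i. ennreal (e * (1 / 2) ^ Suc i)) = ennreal e"
  proof -
    have "(\<lambda>i. e * (1 / 2) ^ Suc i) sums (e * 1)" by (intro sums_mult power_half_series)
    then have "(\<lambda>i. e * (1 / 2) ^ Suc i) sums e" by simp
    then show ?thesis using e by (intro suminf_ennreal_eq) auto
  qed
  also note e(2)
  finally obtain x where "x \<in> limit_set n" "\<forall>i. x \<notin> A i" using ex_limit_point_avoiding by blast
  then show False using assms by blast
qed

lemma packing_measure_limit_set_ge:
  assumes n: "n \<ge> 2"
  shows "ennreal packing_const \<le> packing_measure h (limit_set n)"
  unfolding packing_measure_def
proof (rule INF_greatest)
  fix A :: "nat \<Rightarrow> real set" assume "A \<in> {A. limit_set n \<subseteq> (\<Union>i. A i)}"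
  then have "1 \<le> (\<Sum>i. ennreal (INF l. hit_mass l (A i)))" by (intro cover_hit_mass_ge_1) simp
  then have "ennreal packing_const * 1 \<le> ennreal packing_const * (\<Sum>i. ennreal (INF l. hit_mass l (A i)))"
    by (intro mult_left_mono) auto
  also have "\<dots> = (\<Sum>i. ennreal packing_const * ennreal (INF l. hit_mass l (A i)))"
    by (simp add: ennreal_suminf_cmult)
  also have "\<dots> \<le> (\<Sum>i. packing_premeasure h (A i))"
  proof (intro suminf_le)
    fix i
    have "0 \<le> (INF l. hit_mass l (A i))" by (intro cINF_greatest) (auto simp: hit_mass_nonneg)
    then show "ennreal packing_const * ennreal (INF l. hit_mass l (A i)) \<le> packing_premeasure h (A i)"
      using packing_premeasure_ge[OF n, of "A i"] packing_const_nonneg by (simp add: ennreal_mult)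
  qed auto
  finally show "ennreal packing_const \<le> (\<Sum>i. packing_premeasure h (A i))" by simp
qed

section \<open>Asymptotics\<close>

text \<open>With \<open>u = 1 - h\<close>, every length is at most 1/2, so \<open>wt k\<close> is at
  least \<open>2 powr u * len k\<close>. Summation gives \<open>2 powr u \<le> (n + 1) / n\<close>,
  while \<open>2 powr u\<close> is at least \<open>1 + u / 2\<close>.\<close>

lemma exponent_gap:
  assumes n: "n \<ge> 1"
  shows "1 - h \<le> 2 / real n"
proof -
  define u where "u = 1 - h"
  have u: "0 \<le> u" using h_le_1 by (simp add: u_def)
  have "2 powr u * (\<Sum>k = 1..n. len k) \<le> (\<Sum>k = 1..n. wt k)"
    unfolding sum_distrib_left
  proof (rule sum_mono)
    fix k assume "k \<in> {1..n}"
    then have k: "k \<ge> 1" by simp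
    have "(1 / 2) powr (- u) \<le> len k powr (- u)"
      using len_pos[OF k] len_le_half[OF k] u by (intro powr_mono2') auto
    moreover have "(1 / 2 :: real) powr (- u) = 2 powr u" by (simp add: powr_minus powr_divide)
    ultimately have "2 powr u * len k \<le> len k powr (- u) * len k"
      using len_pos[OF k] by (intro mult_right_mono) auto
    also have "\<dots> = len k powr (- u) * len k powr 1" using len_pos[OF k] by simp
    also have "\<dots> = wt k" by (simp only: powr_add[symmetric]) (simp add: u_def)
    finally show "2 powr u * len k \<le> wt k" .
  qed
  also have "\<dots> = 1" by (rule moran)
  also have "(\<Sum>k = 1..n. len k) = real n / (real n + 1)" using sum_len[of 1 n] by (simp add: field_simps)
  finally have le: "2 powr u \<le> (real n + 1) / real n" using n by (simp add: field_simps)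
  have "u * (1 / 2) \<le> u * ln 2" using ln2_ge_two_thirds u by (intro mult_left_mono) auto
  also have "1 + u * ln 2 \<le> exp (u * ln 2)" by (rule exp_ge_add_one_self)
  also have "exp (u * ln 2) = 2 powr u" by (simp add: powr_def)
  finally have "1 + u / 2 \<le> (real n + 1) / real n" using le by simp
  then show ?thesis using n unfolding u_def[symmetric] by (simp add: field_simps)
qed

lemma distortion_le:
  assumes n: "n \<ge> 1"
  shows "0 < distortion" "distortion \<le> distortion_bound n"
proof -
  show "0 < distortion" using n by (simp add: distortion_def)
  have "1 * 1 \<le> real n * (real n + 1)" using n by (intro mult_mono) auto
  then have "0 \<le> ln (real n * (real n + 1))" by (intro ln_ge_zero) simp
  then have "(1 - h) * ln (real n * (real n + 1)) \<le> 2 / real n * ln (real n * (real n + 1))"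
    using exponent_gap[OF n] by (rule mult_right_mono[rotated])
  moreover have "distortion = exp ((1 - h) * ln (real n * (real n + 1)))"
    using n by (simp add: distortion_def powr_def)
  ultimately show "distortion \<le> distortion_bound n" by (simp add: distortion_bound_def)
qed

lemma two_over_density_bound_le:
  assumes n: "n \<ge> 16"
  shows "2 / density_bound \<le> 2 * distortion_bound n / (1 - 16 / (real n + 1))"
proof -
  have n1: "n \<ge> 1" using n by simp
  have "16 / (real n + 1) < 1" using n by simp
  then show ?thesis using distortion_le[OF n1] by (simp add: density_bound_def divide_right_mono)
qed

text \<open>Up to distortion, the tail weight is the length of the interval from
  \<open>1/(n+1)\<close> to \<open>1/j\<close>. With \<open>j\<close> at least
  \<open>(n - 1) / 2\<close> this is about \<open>1/n\<close>, half the diameter of the chosen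
  ball.\<close>

lemma packing_const_ge:
  assumes n: "n \<ge> 2"
  shows "(2 / (real n + 2)) / (distortion_bound n * (2 / (real n - 1) - 1 / (real n + 1))) \<le> packing_const"
proof -
  have n1: "n \<ge> 1" using n by simp
  define j where "j = n div 2"
  have j: "1 \<le> j" "j \<le> n" "real n \<le> 2 * real j + 1" using n unfolding j_def by linarith+
  have "tail_wt \<le> (\<Sum>k = j..n. distortion * len k)"
    unfolding tail_wt_def j_def[symmetric]
    using j n1 by (intro sum_mono powr_le_distortion len_antimono) auto
  also have "\<dots> = distortion * (1 / real j - 1 / (real n + 1))"
    using j sum_len[of j n] by (simp flip: sum_distrib_left)
  also have "\<dots> \<le> distortion_bound n * (2 / (real n - 1) - 1 / (real n + 1))"
  proof (intro mult_mono)
    have "1 / real j \<le> 2 / (real n - 1)" using j n by (simp add: field_simps)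
    then show "1 / real j - 1 / (real n + 1) \<le> 2 / (real n - 1) - 1 / (real n + 1)" by simp
    have "1 / (real n + 1) \<le> 1 / real j" using j by (intro divide_left_mono) auto
    then show "0 \<le> 1 / real j - 1 / (real n + 1)" by simp
    show "distortion \<le> distortion_bound n" by (rule distortion_le(2)[OF n1])
  qed (simp add: distortion_bound_def)
  finally have tail: "tail_wt \<le> distortion_bound n * (2 / (real n - 1) - 1 / (real n + 1))" .
  have "0 < tail_wt" using tail_wt_bounds[OF n] by linarith
  moreover have "2 / (real n + 2) \<le> (2 / (real n + 2)) powr h"
    using powr_mono'[of h 1 "2 / (real n + 2)"] h_le_1 by simp
  ultimately show ?thesis
    unfolding packing_const_def using tail by (intro frac_le) auto
qed

section \<open>Dimension, existence of the exponent, and the limit\<close>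

lemma packing_dim_limit_set:
  assumes n: "n \<ge> 16"
  shows "packing_dim (limit_set n) = h"
proof (rule packing_dim_eqI)
  have n2: "n \<ge> 2" using n by simp
  have "0 < tail_wt" using tail_wt_bounds[OF n2] by linarith
  then have "0 < packing_const" by (simp add: packing_const_def)
  then have "0 < ennreal packing_const" by simp
  also have "\<dots> \<le> packing_measure h (limit_set n)" by (rule packing_measure_limit_set_ge[OF n2])
  finally show "packing_measure h (limit_set n) > 0" .
qed (use h_nonneg packing_sup_limit_set_le[OF n] in auto)

lemma packing_measure_limit_set_le:
  assumes n: "n \<ge> 16"
  shows "packing_measure h (limit_set n) \<le> ennreal (2 / density_bound)"
proof -
  have "packing_measure h (limit_set n) \<le> packing_premeasure h (limit_set n)"
    by (rule packing_measure_le_premeasure)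
  also have "\<dots> \<le> packing_sup h 1 (limit_set n)"
    unfolding packing_premeasure_def by (intro INF_lower) simp
  also have "\<dots> \<le> ennreal (2 / density_bound)" by (rule packing_sup_limit_set_le[OF n])
  finally show ?thesis .
qed

end

text \<open>The Moran sum is continuous in the exponent, equals \<open>n\<close> at 0 and
  \<open>1 - 1/(n+1)\<close> at 1, so it takes the value 1 in between.\<close>

lemma ex_luroth_ifs:
  assumes "n \<ge> 1"
  shows "\<exists>h. luroth_ifs n h"
proof -
  have "\<exists>h\<ge>0. h \<le> 1 \<and> (\<Sum>k = 1..n. len k powr h) = 1"
  proof (rule IVT2')
    show "(\<Sum>k = 1..n. len k powr 1) \<le> 1"
      using sum_len[of 1 n] len_pos by (simp add: less_imp_le)
    have "(\<Sum>k = 1..n. len k powr 0) = (\<Sum>k = 1..n. 1)" 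
      by (intro sum.cong refl) (use len_pos in force)
    then show "1 \<le> (\<Sum>k = 1..n. len k powr 0)" using assms by simp
    show "continuous_on {0..1} (\<lambda>h. \<Sum>k = 1..n. len k powr h)"
      by (intro continuous_intros) (use len_pos in force)
  qed simp
  then show ?thesis by (auto simp: luroth_ifs_def)
qed

theorem theorem5p16:
  "(\<lambda>n. packing_measure (packing_dim (limit_set n)) (limit_set n)) \<longlonglongrightarrow> 2"
proof (rule tendsto_sandwich)
  let ?P = "\<lambda>n. packing_measure (packing_dim (limit_set n)) (limit_set n)"
  \<comment> \<open>The exponent varies with \<open>n\<close>, so both bounds are first freed of it;
    what remains are explicit functions of \<open>n\<close>.\<close>
  let ?L = "\<lambda>n. (2 / (real n + 2)) / (distortion_bound n * (2 / (real n - 1) - 1 / (real n + 1)))"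
  let ?U = "\<lambda>n. 2 * distortion_bound n / (1 - 16 / (real n + 1))"
  have "?L \<longlonglongrightarrow> 2" "?U \<longlonglongrightarrow> 2" unfolding distortion_bound_def by real_asymp+
  then show "(\<lambda>n. ennreal (?L n)) \<longlonglongrightarrow> 2" "(\<lambda>n. ennreal (?U n)) \<longlonglongrightarrow> 2"
    using tendsto_ennrealI[of ?L 2 sequentially] tendsto_ennrealI[of ?U 2 sequentially] by simp_all
  have "ennreal (?L n) \<le> ?P n \<and> ?P n \<le> ennreal (?U n)" if n: "n \<ge> 16" for n
  proof -
    obtain h where "luroth_ifs n h" using ex_luroth_ifs[of n] n by auto
    then interpret luroth_ifs n h .
    have "ennreal (?L n) \<le> ennreal packing_const" using packing_const_ge n by (intro ennreal_leI) simp
    moreover have "ennreal (2 / density_bound) \<le> ennreal (?U n)"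
      by (intro ennreal_leI two_over_density_bound_le n)
    ultimately show ?thesis
      unfolding packing_dim_limit_set[OF n]
      using packing_measure_limit_set_ge packing_measure_limit_set_le[OF n] n by (auto intro: order_trans)
  qed
  then show "\<forall>\<^sub>F n in sequentially. ennreal (?L n) \<le> ?P n" "\<forall>\<^sub>F n in sequentially. ?P n \<le> ennreal (?U n)"
    by (auto simp: eventually_sequentially)
qed

end
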